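(* Let $n\ge1$, let $X\subseteq\mathbb{A}^{n+1}_{\mathbb{C}}$ be an algebraic curve with defining polynomials $f_1,\dots,f_r\in\mathbb{C}[x,y_1,\dots,y_n]$ and with $0\in X$ a smooth point. Let $\gamma(t)=(x(t),y_1(t),\dots,y_n(t))\in\mathbb{C}[[t]]^{n+1}$ be a parametrization of $X$ at $0$ with $x'(t)\neq 0$ (as a power series). For $1\le j\le n$ and $i\ge1$ let $\widetilde s_j$ and $\widetilde\kappa_{i,j}$ be implicit expressions of $s_j(t)$ and $\kappa_{i,j}(t)$, i.e. quotients of elements of $$\mathbb{C}[\partial_x^{i_0}\partial_{y_1}^{i_1}\cdots\partial_{y_n}^{i_n}f_k : i_0,\dots,i_n\in\mathbb{N},\ 1\le k\le r]\subseteq\mathbb{C}[x,y_1,\dots,y_n]$$ such that $$s_j(t)=\widetilde s_j(\gamma(t)),\qquad \kappa_{i,j}(t)=\widetilde\kappa_{i,j}(\gamma(t)),$$ and suppose that all $\widetilde s_j$ and $\widetilde\kappa_{i,j}$ have finite value at $0$ (their denominators do not vanish at $0$). Then the analytic branch of $X$ at $0$ is defined by the ideal $$\mathcal{I}_X=\left(y_j-\widetilde s_j(0)\cdot x-\sum_{i\ge1}\frac{\widetilde\kappa_{i,j}(0)}{(i+1)!}\,x^{i+1} \ :\ 1\le j\le n\right),$$ that is, these power series converge near $0$ and the analytic germ of $X$ at $0$ is the germ defined by $\mathcal{I}_X$.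
   Context: An algebraic curve is a Zariski closed subset of pure dimension $1$ and its defining polynomials $f_1,\dots,f_r$ generate its (radical) vanishing ideal $I$. A parametrization of $X$ at $0$ is a tuple $\gamma(t)=(x(t),y_1(t),\dots,y_n(t))\in\mathbb{C}[[t]]^{n+1}$ with $\gamma(0)=0$ for which $x\mapsto x(t)$, $y_j\mapsto y_j(t)$ induces a well-defined injective ring map $\mathbb{C}[[x,y_1,\dots,y_n]]/(I)\to\mathbb{C}[[t]]$. For such $\gamma$ the slopes and algebraic curvatures are the elements of $\mathbb{C}((t))$ given by $$s_j(t)=\frac{y_j'(t)}{x'(t)},\qquad \kappa_{1,j}(t)=\frac{y_j''(t)x'(t)-y_j'(t)x''(t)}{x'(t)^3},\qquad \kappa_{i,j}(t)=\frac{\partial_t\kappa_{i-1,j}(t)}{x'(t)}\ (i\ge2).$$ *)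

theory Defs
  imports
    "HOL-Analysis.Analysis"
    "HOL-Computational_Algebra.Formal_Laurent_Series"
    "HOL-Library.Poly_Mapping"
begin

text \<open>
  Throughout, \<open>'v\<close> is a finite type of variables. Affine space with these coordinates is
  \<open>complex ^ 'v\<close>. For the coordinates \<open>x, y\<^sub>1, \<dots>, y\<^sub>n\<close> the type of variables is
  \<open>'n option\<close>: \<open>None\<close> is \<open>x\<close>, \<open>Some j\<close> is \<open>y\<^sub>j\<close>, and \<open>n = CARD('n) \<ge> 1\<close>.
\<close>

definition ideal_generated :: "'a::comm_ring_1 set \<Rightarrow> 'a set" where
  "ideal_generated S = module.span (*) S"


section \<open>Polynomials in several variables\<close>

type_synonym 'v mpoly = "('v \<Rightarrow>\<^sub>0 nat) \<Rightarrow>\<^sub>0 complex"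

definition mpoly_const :: "complex \<Rightarrow> 'v mpoly" where
  "mpoly_const c = Poly_Mapping.single 0 c"

definition mpoly_eval :: "'v::finite mpoly \<Rightarrow> complex ^ 'v \<Rightarrow> complex" where
  "mpoly_eval p a =
     (\<Sum>m\<in>Poly_Mapping.keys p. Poly_Mapping.lookup p m * (\<Prod>v\<in>UNIV. (a $ v) ^ Poly_Mapping.lookup m v))"

definition mpoly_fps :: "'v::finite mpoly \<Rightarrow> ('v \<Rightarrow> complex fps) \<Rightarrow> complex fps" where
  "mpoly_fps p \<gamma> =
     (\<Sum>m\<in>Poly_Mapping.keys p. fps_const (Poly_Mapping.lookup p m) * (\<Prod>v\<in>UNIV. \<gamma> v ^ Poly_Mapping.lookup m v))"

text \<open>Subtraction of exponents truncates, but only where the coefficient \<open>Poly_Mapping.lookup m v\<close> is 0.\<close>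

definition mpoly_deriv :: "'v \<Rightarrow> 'v mpoly \<Rightarrow> 'v mpoly" where
  "mpoly_deriv v p =
     (\<Sum>m\<in>Poly_Mapping.keys p. Poly_Mapping.single (m - Poly_Mapping.single v 1)
                     (of_nat (Poly_Mapping.lookup m v) * Poly_Mapping.lookup p m))"

text \<open>All partial derivatives of the members of \<open>F\<close>, of all orders including 0.\<close>

inductive_set partials :: "'v mpoly set \<Rightarrow> 'v mpoly set" for F where
  base: "p \<in> F \<Longrightarrow> p \<in> partials F"
| deriv: "p \<in> partials F \<Longrightarrow> mpoly_deriv v p \<in> partials F"

inductive_set subalgebra_generated :: "'v mpoly set \<Rightarrow> 'v mpoly set" for S where
  const: "mpoly_const c \<in> subalgebra_generated S"
| gen: "p \<in> S \<Longrightarrow> p \<in> subalgebra_generated S"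
| add: "p \<in> subalgebra_generated S \<Longrightarrow> q \<in> subalgebra_generated S \<Longrightarrow>
        p + q \<in> subalgebra_generated S"
| mult: "p \<in> subalgebra_generated S \<Longrightarrow> q \<in> subalgebra_generated S \<Longrightarrow>
         p * q \<in> subalgebra_generated S"


section \<open>Algebraic curves\<close>

definition zariski_closed :: "(complex ^ 'v::finite) set \<Rightarrow> bool" where
  "zariski_closed X \<longleftrightarrow> (\<exists>S. X = {a. \<forall>p\<in>S. mpoly_eval p a = 0})"

definition vanishing_ideal :: "(complex ^ 'v::finite) set \<Rightarrow> 'v mpoly set" where
  "vanishing_ideal X = {p. \<forall>a\<in>X. mpoly_eval p a = 0}"

definition irreducible_closed :: "(complex ^ 'v::finite) set \<Rightarrow> bool" where
  "irreducible_closed Z \<longleftrightarrow> zariski_closed Z \<and> Z \<noteq> {} \<and>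
     (\<forall>A B. zariski_closed A \<longrightarrow> zariski_closed B \<longrightarrow> Z = A \<union> B \<longrightarrow> Z = A \<or> Z = B)"

definition irreducible_component :: "(complex ^ 'v::finite) set \<Rightarrow> (complex ^ 'v) set \<Rightarrow> bool" where
  "irreducible_component X Z \<longleftrightarrow> irreducible_closed Z \<and> Z \<subseteq> X \<and>
     (\<forall>W. irreducible_closed W \<longrightarrow> W \<subseteq> X \<longrightarrow> Z \<subseteq> W \<longrightarrow> W = Z)"

text \<open>Only used for nonempty sets (the empty set gets 0).\<close>

definition zariski_dim :: "(complex ^ 'v::finite) set \<Rightarrow> enat" where
  "zariski_dim X = Sup {enat k | k. \<exists>Z :: nat \<Rightarrow> (complex ^ 'v) set.
     (\<forall>i\<le>k. irreducible_closed (Z i) \<and> Z i \<subseteq> X) \<and> (\<forall>i<k. Z i \<subset> Z (Suc i))}"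

definition algebraic_curve :: "(complex ^ 'v::finite) set \<Rightarrow> bool" where
  "algebraic_curve X \<longleftrightarrow> zariski_closed X \<and>
     (\<forall>Z. irreducible_component X Z \<longrightarrow> zariski_dim Z = 1)"

definition gradient :: "'v::finite mpoly \<Rightarrow> complex ^ 'v \<Rightarrow> complex ^ 'v" where
  "gradient p a = (\<chi> v. mpoly_eval (mpoly_deriv v p) a)"

text \<open>
  The Jacobian criterion: the Jacobian matrix of the generators \<open>F\<close> of the vanishing ideal of a
  curve has (row) rank the number of variables minus one.
\<close>

definition smooth_curve_point ::
    "'v::finite mpoly set \<Rightarrow> (complex ^ 'v) set \<Rightarrow> complex ^ 'v \<Rightarrow> bool" where
  "smooth_curve_point F X a \<longleftrightarrow> a \<in> X \<and> vec.dim ((\<lambda>p. gradient p a) ` F) = CARD('v) - 1"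


section \<open>Formal power series in several variables\<close>

typedef 'v mfps = "UNIV :: (('v \<Rightarrow>\<^sub>0 nat) \<Rightarrow> complex) set"
  morphisms mfps_coeff Abs_mfps by simp

lemma mfps_coeff_Abs [simp]: "mfps_coeff (Abs_mfps f) = f"
  by (simp add: Abs_mfps_inverse)

lemma mfps_eqI: "(\<And>m. mfps_coeff F m = mfps_coeff G m) \<Longrightarrow> F = G"
  by (metis ext mfps_coeff_inject)

definition splits :: "('v \<Rightarrow>\<^sub>0 nat) \<Rightarrow> (('v \<Rightarrow>\<^sub>0 nat) \<times> ('v \<Rightarrow>\<^sub>0 nat)) set" where
  "splits m = {(a, b). a + b = m}"

lemma finite_le_poly_mapping: "finite {a :: 'v::finite \<Rightarrow>\<^sub>0 nat. \<forall>v. Poly_Mapping.lookup a v \<le> N}"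
proof (rule finite_imageD)
  have "Poly_Mapping.lookup ` {a :: 'v \<Rightarrow>\<^sub>0 nat. \<forall>v. Poly_Mapping.lookup a v \<le> N} \<subseteq> (\<Pi>\<^sub>E v\<in>UNIV. {..N})"
    by auto
  then show "finite (Poly_Mapping.lookup ` {a :: 'v \<Rightarrow>\<^sub>0 nat. \<forall>v. Poly_Mapping.lookup a v \<le> N})"
    by (rule finite_subset) (simp add: finite_PiE)
  show "inj_on Poly_Mapping.lookup {a :: 'v \<Rightarrow>\<^sub>0 nat. \<forall>v. Poly_Mapping.lookup a v \<le> N}"
    by (simp add: inj_on_def)
qed

lemma finite_splits [simp]: "finite (splits (m :: 'v::finite \<Rightarrow>\<^sub>0 nat))"
proof -
  have le: "Poly_Mapping.lookup m v \<le> (\<Sum>w\<in>UNIV. Poly_Mapping.lookup m w)" for v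
    by (rule member_le_sum) auto
  define B where "B = {a :: 'v \<Rightarrow>\<^sub>0 nat. \<forall>v. Poly_Mapping.lookup a v \<le> (\<Sum>w\<in>UNIV. Poly_Mapping.lookup m w)}"
  have "splits m \<subseteq> B \<times> B"
  proof (clarsimp simp: splits_def)
    fix a b :: "'v \<Rightarrow>\<^sub>0 nat" assume m: "m = a + b"
    have "Poly_Mapping.lookup a v \<le> Poly_Mapping.lookup m v" "Poly_Mapping.lookup b v \<le> Poly_Mapping.lookup m v" for v
      unfolding m by (simp_all add: lookup_add)
    then show "a \<in> B \<and> b \<in> B"
      using le m unfolding B_def by (blast intro: order_trans)
  qed
  moreover have "finite (B \<times> B)"
    unfolding B_def by (intro finite_cartesian_product finite_le_poly_mapping)
  ultimately show ?thesis by (rule finite_subset)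
qed

instantiation mfps :: (finite) comm_ring_1
begin

definition "0 = Abs_mfps (\<lambda>_. 0)"
definition "1 = Abs_mfps (\<lambda>m. if m = 0 then 1 else 0)"
definition "F + G = Abs_mfps (\<lambda>m. mfps_coeff F m + mfps_coeff G m)"
definition "F - G = Abs_mfps (\<lambda>m. mfps_coeff F m - mfps_coeff G m)"
definition "- F = Abs_mfps (\<lambda>m. - mfps_coeff F m)"
definition "F * G = Abs_mfps (\<lambda>m. \<Sum>(a, b)\<in>splits m. mfps_coeff F a * mfps_coeff G b)"

instance
proof
  fix F G H :: "'a mfps"
  show "F * G * H = F * (G * H)"
  proof (rule mfps_eqI)
    fix m :: "'a \<Rightarrow>\<^sub>0 nat"
    have "mfps_coeff (F * G * H) m =
      (\<Sum>(x, y)\<in>Sigma (splits m) (\<lambda>x. splits (fst x)).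
         mfps_coeff F (fst y) * mfps_coeff G (snd y) * mfps_coeff H (snd x))"
      by (simp add: times_mfps_def sum_distrib_right case_prod_unfold sum.Sigma)
    also have "\<dots> =
      (\<Sum>(x, y)\<in>Sigma (splits m) (\<lambda>x. splits (snd x)).
         mfps_coeff F (fst x) * (mfps_coeff G (fst y) * mfps_coeff H (snd y)))"
      by (rule sum.reindex_bij_witness
            [where i = "\<lambda>(x, y). ((fst x + fst y, snd y), (fst x, fst y))"
               and j = "\<lambda>(x, y). ((fst y, snd y + snd x), (snd y, snd x))"])
         (auto simp: splits_def add_ac mult_ac)
    also have "\<dots> = mfps_coeff (F * (G * H)) m"
      by (simp add: times_mfps_def sum_distrib_left case_prod_unfold sum.Sigma)
    finally show "mfps_coeff (F * G * H) m = mfps_coeff (F * (G * H)) m" .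
  qed
  show "F * G = G * F"
  proof (rule mfps_eqI)
    fix m :: "'a \<Rightarrow>\<^sub>0 nat"
    show "mfps_coeff (F * G) m = mfps_coeff (G * F) m"
      unfolding times_mfps_def mfps_coeff_Abs
      by (rule sum.reindex_bij_witness[where i = prod.swap and j = prod.swap])
         (auto simp: splits_def add_ac mult_ac)
  qed
  show "1 * F = F"
  proof (rule mfps_eqI)
    fix m :: "'a \<Rightarrow>\<^sub>0 nat"
    have "mfps_coeff (1 * F) m =
        (\<Sum>x\<in>splits m. if x = (0, m) then mfps_coeff F m else 0)"
      unfolding times_mfps_def one_mfps_def mfps_coeff_Abs
    proof (rule sum.cong)
      fix x assume "x \<in> splits m"
      then show "(case x of (a, b) \<Rightarrow> (if a = 0 then 1 else 0) * mfps_coeff F b) =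
          (if x = (0, m) then mfps_coeff F m else 0)"
        by (cases x; cases "fst x = 0") (simp_all add: splits_def)
    qed simp
    also have "\<dots> = mfps_coeff F m"
      by (subst sum.delta[OF finite_splits]) (simp add: splits_def)
    finally show "mfps_coeff (1 * F) m = mfps_coeff F m" .
  qed
  show "(F + G) * H = F * H + G * H"
    by (rule mfps_eqI)
       (simp add: times_mfps_def plus_mfps_def case_prod_unfold distrib_right sum.distrib)
  show "(0 :: 'a mfps) \<noteq> 1"
  proof
    assume "(0 :: 'a mfps) = 1"
    then have "mfps_coeff (0 :: 'a mfps) 0 = mfps_coeff 1 0" by simp
    then show False by (simp add: zero_mfps_def one_mfps_def)
  qed
qed (auto intro!: mfps_eqI simp: plus_mfps_def minus_mfps_def uminus_mfps_def zero_mfps_def)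

end

definition mfps_of_mpoly :: "'v mpoly \<Rightarrow> 'v mfps" where
  "mfps_of_mpoly p = Abs_mfps (Poly_Mapping.lookup p)"

text \<open>The image of a univariate power series under \<open>\<complex>[[v]] \<subseteq> \<complex>[[all variables]]\<close>.\<close>

definition mfps_of_fps :: "'v \<Rightarrow> complex fps \<Rightarrow> 'v mfps" where
  "mfps_of_fps v h =
     Abs_mfps (\<lambda>m. if m = Poly_Mapping.single v (Poly_Mapping.lookup m v) then fps_nth h (Poly_Mapping.lookup m v) else 0)"

definition mfps_var :: "'v \<Rightarrow> 'v mfps" where
  "mfps_var v = mfps_of_fps v fps_X"

text \<open>
  The substitution \<open>F(\<gamma>(t))\<close> for \<open>\<gamma>(0) = 0\<close>: as every \<open>\<gamma> v\<close> is divisible by \<open>t\<close>, only the finitely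
  many monomials of total degree at most \<open>k\<close> contribute to the coefficient of \<open>t\<^sup>k\<close>.
\<close>

definition mfps_subst :: "'v::finite mfps \<Rightarrow> ('v \<Rightarrow> complex fps) \<Rightarrow> complex fps" where
  "mfps_subst F \<gamma> = Abs_fps (\<lambda>k.
     \<Sum>m | (\<Sum>v\<in>UNIV. Poly_Mapping.lookup m v) \<le> k.
       mfps_coeff F m * fps_nth (\<Prod>v\<in>UNIV. \<gamma> v ^ Poly_Mapping.lookup m v) k)"

text \<open>
  The two directions of the equivalence say that \<open>F \<mapsto> F(\<gamma>(t))\<close> is well-defined and injective on
  \<open>\<complex>[[x, y\<^sub>1, \<dots>, y\<^sub>n]]/(I)\<close>.
\<close>

definition parametrization :: "(complex ^ 'v::finite) set \<Rightarrow> ('v \<Rightarrow> complex fps) \<Rightarrow> bool" where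
  "parametrization X \<gamma> \<longleftrightarrow> (\<forall>v. fps_nth (\<gamma> v) 0 = 0) \<and>
     (\<forall>F G. F - G \<in> ideal_generated (mfps_of_mpoly ` vanishing_ideal X) \<longleftrightarrow>
            mfps_subst F \<gamma> = mfps_subst G \<gamma>)"


section \<open>Slopes, algebraic curvatures and their implicit expressions\<close>

definition slope :: "complex fps \<Rightarrow> complex fps \<Rightarrow> complex fls" where
  "slope x y = fps_to_fls (fps_deriv y) / fps_to_fls (fps_deriv x)"

text \<open>The curvatures are indexed from 1; the value at index 0 is a dummy.\<close>

fun curvature :: "complex fps \<Rightarrow> complex fps \<Rightarrow> nat \<Rightarrow> complex fls" where
  "curvature x y 0 = 0"
| "curvature x y (Suc 0) =
     fps_to_fls (fps_deriv (fps_deriv y) * fps_deriv x - fps_deriv y * fps_deriv (fps_deriv x))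
       / fps_to_fls (fps_deriv x) ^ 3"
| "curvature x y (Suc (Suc i)) =
     fls_deriv (curvature x y (Suc i)) / fps_to_fls (fps_deriv x)"

text \<open>A quotient of polynomials is given by its numerator and denominator.\<close>

type_synonym 'v mquot = "'v mpoly \<times> 'v mpoly"

definition implicit_expression ::
    "'v::finite mpoly set \<Rightarrow> ('v \<Rightarrow> complex fps) \<Rightarrow> complex fls \<Rightarrow> 'v mquot \<Rightarrow> bool" where
  "implicit_expression F \<gamma> s e \<longleftrightarrow>
     fst e \<in> subalgebra_generated (partials F) \<and>
     snd e \<in> subalgebra_generated (partials F) \<and>
     mpoly_fps (snd e) \<gamma> \<noteq> 0 \<and>
     s = fps_to_fls (mpoly_fps (fst e) \<gamma>) / fps_to_fls (mpoly_fps (snd e) \<gamma>)"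

definition finite_at_0 :: "'v::finite mquot \<Rightarrow> bool" where
  "finite_at_0 e \<longleftrightarrow> mpoly_eval (snd e) 0 \<noteq> 0"

definition value_at_0 :: "'v::finite mquot \<Rightarrow> complex" where
  "value_at_0 e = mpoly_eval (fst e) 0 / mpoly_eval (snd e) 0"


section \<open>Analytic germs at the origin\<close>

definition mfps_term :: "'v::finite mfps \<Rightarrow> complex ^ 'v \<Rightarrow> ('v \<Rightarrow>\<^sub>0 nat) \<Rightarrow> complex" where
  "mfps_term F a m = mfps_coeff F m * (\<Prod>v\<in>UNIV. (a $ v) ^ Poly_Mapping.lookup m v)"

text \<open>Summability is unconditional, hence absolute.\<close>

definition mfps_convergent :: "'v::finite mfps \<Rightarrow> bool" where
  "mfps_convergent F \<longleftrightarrow> (\<forall>\<^sub>F a in nhds 0. mfps_term F a summable_on UNIV)"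

definition mfps_eval :: "'v::finite mfps \<Rightarrow> complex ^ 'v \<Rightarrow> complex" where
  "mfps_eval F a = infsum (mfps_term F a) UNIV"

text \<open>The ideal of the ring \<open>\<complex>{x, y\<^sub>1, \<dots>, y\<^sub>n}\<close> of convergent series generated by a finite set \<open>S\<close>.\<close>

definition convergent_ideal :: "'v::finite mfps set \<Rightarrow> 'v mfps set" where
  "convergent_ideal S = {\<Sum>g\<in>S. c g * g | c. \<forall>g\<in>S. mfps_convergent (c g)}"

text \<open>
  The germ at 0 of the set \<open>X\<close> is the germ defined by the ideal \<open>J\<close> of \<open>\<complex>{x, y\<^sub>1, \<dots>, y\<^sub>n}\<close>, that is,
  the germ of the common zeros of finitely many generators of \<open>J\<close>; this germ does not depend on
  the choice of the generators.
\<close>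

definition germ_defined_by :: "(complex ^ 'v::finite) set \<Rightarrow> 'v mfps set \<Rightarrow> bool" where
  "germ_defined_by X J \<longleftrightarrow>
     (\<exists>S. finite S \<and> (\<forall>g\<in>S. mfps_convergent g) \<and> J = convergent_ideal S \<and>
          (\<forall>\<^sub>F a in nhds 0. a \<in> X \<longleftrightarrow> (\<forall>g\<in>S. mfps_eval g a = 0)))"

text \<open>The power series \<open>y\<^sub>j - s x - (\<Sum>i\<ge>1. k i / (i+1)! x\<^sup>i\<^sup>+\<^sup>1)\<close>.\<close>

definition branch_equation :: "'n \<Rightarrow> complex \<Rightarrow> (nat \<Rightarrow> complex) \<Rightarrow> 'n::finite option mfps" where
  "branch_equation j s k =
     mfps_var (Some j) -
     mfps_of_fps None (fps_const s * fps_X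
       + Abs_fps (\<lambda>m. if m \<ge> 2 then k (m - 1) / fact m else 0))"

end

theory Submission
  imports Defs "HOL-Complex_Analysis.Complex_Analysis"
begin

text \<open>
  As all \<open>s\<^sub>j(t)\<close> are power series, \<open>(1, s\<^sub>1(0), \<dots>, s\<^sub>n(0))\<close> spans the tangent line, so it is not
  vertical and some \<open>n\<close> of the \<open>f\<^sub>k\<close> have an invertible Jacobian with respect to \<open>y\<^sub>1, \<dots>, y\<^sub>n\<close>. By the
  implicit function theorem their zero set near 0 is the graph of convergent series \<open>h\<^sub>j\<close>, and by
  formal uniqueness \<open>y\<^sub>j(t) = h\<^sub>j(x(t))\<close>. Hence \<open>f\<^sub>k(x, h(x))\<close> vanishes after substituting
  \<open>x(t) \<noteq> 0\<close>, for all \<open>k\<close>, so it is 0 and \<open>X\<close> is the whole graph. Moreover \<open>s\<^sub>j(t) = h\<^sub>j'(x(t))\<close>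
  and \<open>\<kappa>\<^sub>i\<^sub>,\<^sub>j(t)\<close> is the derivative of \<open>h\<^sub>j\<close> of order \<open>i + 1\<close> at \<open>x(t)\<close>; at \<open>t = 0\<close> these are
  the Taylor coefficients of \<open>h\<^sub>j\<close>.
\<close>

section \<open>Polynomials\<close>

definition mpoly_var :: "'v \<Rightarrow> 'v mpoly" where
  "mpoly_var v = Poly_Mapping.single (Poly_Mapping.single v 1) 1"

lemma mpoly_monomial_sum:
  fixes p :: "'v mpoly"
  shows "(\<Sum>m\<in>Poly_Mapping.keys p. Poly_Mapping.single m (Poly_Mapping.lookup p m)) = p"
  by (rule poly_mapping_eqI) (auto simp: lookup_sum lookup_single when_def in_keys_iff)

lemma monomial_split:
  fixes m :: "'v \<Rightarrow>\<^sub>0 nat"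
  assumes "Poly_Mapping.lookup m v > 0"
  shows "Poly_Mapping.single v 1 + (m - Poly_Mapping.single v 1) = m"
  using assms by (intro poly_mapping_eqI) (auto simp: lookup_add lookup_minus lookup_single when_def)

text \<open>Monomials arise by induction on the total degree, polynomials by adding their terms.
  Evaluation, substitution and differentiation are sums over \<open>keys\<close>, which handle
  products badly; this rule reduces their laws to multiplication by one variable.\<close>

lemma mpoly_induct [case_names const add var_mult]:
  fixes p :: "'v::finite mpoly"
  assumes const: "\<And>c. P (mpoly_const c)"
    and add: "\<And>p q. P p \<Longrightarrow> P q \<Longrightarrow> P (p + q)"
    and var_mult: "\<And>v p. P p \<Longrightarrow> P (mpoly_var v * p)"
  shows "P p"
proof -
  have single: "P (Poly_Mapping.single m c)" for m c
  proof (induction "\<Sum>v\<in>UNIV. Poly_Mapping.lookup m v" arbitrary: m rule: less_induct)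
    case (less m)
    show ?case
    proof (cases "m = 0")
      case True
      then show ?thesis using const[of c] by (simp add: mpoly_const_def)
    next
      case False
      then obtain v where v: "Poly_Mapping.lookup m v > 0"
        by (metis gr0I lookup_zero poly_mapping_eqI)
      define m' where "m' = m - Poly_Mapping.single v 1"
      have m: "Poly_Mapping.single v 1 + m' = m"
        unfolding m'_def by (rule monomial_split[OF v])
      have "(\<Sum>v\<in>UNIV. Poly_Mapping.lookup m' v) < (\<Sum>v\<in>UNIV. Poly_Mapping.lookup m v)"
        using v by (intro sum_strict_mono_ex1) (auto simp: m'_def lookup_minus lookup_single when_def)
      then have "P (mpoly_var v * Poly_Mapping.single m' c)"
        by (intro var_mult less)
      then show ?thesis
        by (simp only: mpoly_var_def mult_single m mult_1)
    qed
  qed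
  have "P (\<Sum>m\<in>A. Poly_Mapping.single m (Poly_Mapping.lookup p m))" if "finite A" for A
    using that
  proof induction
    case empty
    show ?case using const[of 0] by (simp add: mpoly_const_def)
  qed (auto intro: add single)
  from this[of "Poly_Mapping.keys p"] show ?thesis
    by (simp add: mpoly_monomial_sum)
qed

lemma mpoly_mult_sum:
  fixes q :: "'v mpoly"
  shows "q * p = (\<Sum>m\<in>Poly_Mapping.keys p. q * Poly_Mapping.single m (Poly_Mapping.lookup p m))"
  by (simp add: mpoly_monomial_sum flip: sum_distrib_left)

section \<open>Additivity and values on monomials\<close>

lemma mpoly_eval_add: "mpoly_eval (p + q) a = mpoly_eval p a + mpoly_eval q a"
  unfolding mpoly_eval_def by (rule setsum_keys_plus_distrib) (simp_all add: algebra_simps)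

lemma mpoly_fps_add: "mpoly_fps (p + q) \<gamma> = mpoly_fps p \<gamma> + mpoly_fps q \<gamma>"
  unfolding mpoly_fps_def
  by (rule setsum_keys_plus_distrib) (simp_all add: algebra_simps flip: fps_const_add)

lemma mpoly_deriv_add: "mpoly_deriv v (p + q) = mpoly_deriv v p + mpoly_deriv v q"
  unfolding mpoly_deriv_def
  by (rule setsum_keys_plus_distrib) (simp_all add: algebra_simps flip: single_add)

lemma mpoly_eval_0 [simp]: "mpoly_eval 0 a = 0"
  by (simp add: mpoly_eval_def)

lemma mpoly_fps_0 [simp]: "mpoly_fps 0 \<gamma> = 0"
  by (simp add: mpoly_fps_def)

lemma mpoly_deriv_0 [simp]: "mpoly_deriv v 0 = 0"
  by (simp add: mpoly_deriv_def)

lemma mpoly_eval_sum: "mpoly_eval (\<Sum>i\<in>A. p i) a = (\<Sum>i\<in>A. mpoly_eval (p i) a)"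
  by (induction A rule: infinite_finite_induct) (simp_all add: mpoly_eval_add)

lemma mpoly_fps_sum: "mpoly_fps (\<Sum>i\<in>A. p i) \<gamma> = (\<Sum>i\<in>A. mpoly_fps (p i) \<gamma>)"
  by (induction A rule: infinite_finite_induct) (simp_all add: mpoly_fps_add)

lemma mpoly_deriv_sum: "mpoly_deriv v (\<Sum>i\<in>A. p i) = (\<Sum>i\<in>A. mpoly_deriv v (p i))"
  by (induction A rule: infinite_finite_induct) (simp_all add: mpoly_deriv_add)

lemma mpoly_eval_single:
  "mpoly_eval (Poly_Mapping.single m c) a = c * (\<Prod>v\<in>UNIV. (a $ v) ^ Poly_Mapping.lookup m v)"
  by (simp add: mpoly_eval_def)

lemma mpoly_fps_single:
  "mpoly_fps (Poly_Mapping.single m c) \<gamma> = fps_const c * (\<Prod>v\<in>UNIV. \<gamma> v ^ Poly_Mapping.lookup m v)"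
  by (simp add: mpoly_fps_def)

lemma mpoly_deriv_single:
  "mpoly_deriv v (Poly_Mapping.single m c) =
     Poly_Mapping.single (m - Poly_Mapping.single v 1) (of_nat (Poly_Mapping.lookup m v) * c)"
  by (simp add: mpoly_deriv_def)

lemma mpoly_eval_const [simp]: "mpoly_eval (mpoly_const c) a = c"
  by (simp add: mpoly_const_def mpoly_eval_single)

lemma mpoly_fps_const [simp]: "mpoly_fps (mpoly_const c) \<gamma> = fps_const c"
  by (simp add: mpoly_const_def mpoly_fps_single)

lemma mpoly_deriv_const [simp]: "mpoly_deriv v (mpoly_const c) = 0"
  by (simp add: mpoly_const_def mpoly_deriv_single)

section \<open>Behaviour under products\<close>

lemma prod_power_monomial_var:
  fixes g :: "'v::finite \<Rightarrow> 'a::comm_semiring_1"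
  shows "(\<Prod>w\<in>UNIV. g w ^ Poly_Mapping.lookup (Poly_Mapping.single v 1 + m) w) =
         g v * (\<Prod>w\<in>UNIV. g w ^ Poly_Mapping.lookup m w)"
proof -
  have "(\<Prod>w\<in>UNIV. g w ^ Poly_Mapping.lookup (Poly_Mapping.single v (1::nat)) w) = g v"
    by (subst prod.remove[of _ v]) (auto simp: lookup_single when_def intro!: prod.neutral)
  then show ?thesis
    by (simp add: lookup_add power_add prod.distrib)
qed

lemma mpoly_eval_var_mult [simp]: "mpoly_eval (mpoly_var v * p) a = a $ v * mpoly_eval p a"
proof -
  have "mpoly_eval (mpoly_var v * p) a =
      (\<Sum>m\<in>Poly_Mapping.keys p. a $ v * mpoly_eval (Poly_Mapping.single m (Poly_Mapping.lookup p m)) a)"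
    by (subst mpoly_mult_sum)
       (simp only: mpoly_eval_sum mpoly_var_def mult_single mpoly_eval_single prod_power_monomial_var
         mult_1 mult.left_commute)
  also have "\<dots> = a $ v * mpoly_eval p a"
    by (simp add: mpoly_monomial_sum flip: sum_distrib_left mpoly_eval_sum)
  finally show ?thesis .
qed

lemma mpoly_fps_var_mult [simp]: "mpoly_fps (mpoly_var v * p) \<gamma> = \<gamma> v * mpoly_fps p \<gamma>"
proof -
  have "mpoly_fps (mpoly_var v * p) \<gamma> =
      (\<Sum>m\<in>Poly_Mapping.keys p. \<gamma> v * mpoly_fps (Poly_Mapping.single m (Poly_Mapping.lookup p m)) \<gamma>)"
    by (subst mpoly_mult_sum)
       (simp only: mpoly_fps_sum mpoly_var_def mult_single mpoly_fps_single prod_power_monomial_var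
         mult_1 mult.left_commute)
  also have "\<dots> = \<gamma> v * mpoly_fps p \<gamma>"
    by (simp add: mpoly_monomial_sum flip: sum_distrib_left mpoly_fps_sum)
  finally show ?thesis .
qed

lemma mpoly_deriv_var_mult [simp]:
  "mpoly_deriv w (mpoly_var v * p) = (if v = w then p else 0) + mpoly_var v * mpoly_deriv w p"
proof -
  have mono: "mpoly_deriv w (mpoly_var v * Poly_Mapping.single m c) =
      (if v = w then Poly_Mapping.single m c else 0) + mpoly_var v * mpoly_deriv w (Poly_Mapping.single m c)"
    for m c
  \<comment> \<open>If \<open>w\<close> does not occur in \<open>m\<close>, the derivative of the
    monomial has coefficient 0, so truncation does no harm. Otherwise subtracting the exponent is
    exact and commutes with adding that of \<open>v\<close>.\<close>
  proof (cases "Poly_Mapping.lookup m w = 0")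
    case True
    moreover have "Poly_Mapping.single v 1 + m - Poly_Mapping.single v 1 = m"
      by (rule poly_mapping_eqI) (simp add: lookup_add lookup_minus)
    ultimately show ?thesis
      by (simp add: mpoly_var_def mult_single mpoly_deriv_single lookup_add lookup_single when_def)
  next
    case False
    have "Poly_Mapping.single v 1 + m - Poly_Mapping.single w 1 =
        Poly_Mapping.single v 1 + (m - Poly_Mapping.single w 1)"
      using False by (intro poly_mapping_eqI) (auto simp: lookup_add lookup_minus lookup_single when_def)
    moreover have "Poly_Mapping.single w 1 + (m - Poly_Mapping.single w 1) = m"
      using False by (intro monomial_split) simp
    ultimately show ?thesis
      by (cases "v = w")
         (simp_all add: mpoly_var_def mult_single mpoly_deriv_single lookup_add lookup_single
           distrib_right single_add)
  qed
  have "mpoly_deriv w (mpoly_var v * p) = (\<Sum>m\<in>Poly_Mapping.keys p.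
      mpoly_deriv w (mpoly_var v * Poly_Mapping.single m (Poly_Mapping.lookup p m)))"
    by (subst mpoly_mult_sum) (rule mpoly_deriv_sum)
  also have "\<dots> = (if v = w then p else 0) + mpoly_var v * mpoly_deriv w p"
    by (simp add: mono sum.distrib mpoly_monomial_sum flip: sum_distrib_left mpoly_deriv_sum)
  finally show ?thesis .
qed

lemma mpoly_eval_mult [simp]: "mpoly_eval (p * q) a = mpoly_eval p a * mpoly_eval q a"
proof (induction p rule: mpoly_induct)
  case (const c)
  \<comment> \<open>A constant factor is not covered by the rule for a variable factor, so it gets
    its own induction, on \<open>q\<close>.\<close>
  show ?case
  proof (induction q rule: mpoly_induct)
    case (const d)
    have "mpoly_const c * mpoly_const d = (mpoly_const (c * d) :: 'a mpoly)"
      by (simp add: mpoly_const_def mult_single)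
    then show ?case by simp
  next
    case (var_mult v q)
    have "mpoly_eval (mpoly_const c * (mpoly_var v * q)) a = a $ v * mpoly_eval (mpoly_const c * q) a"
      by (subst mult.left_commute) (rule mpoly_eval_var_mult)
    with var_mult show ?case by simp
  qed (simp add: mpoly_eval_add distrib_left)
qed (simp_all add: mpoly_eval_add distrib_right mult.assoc)

lemma mpoly_eval_var [simp]: "mpoly_eval (mpoly_var v) a = a $ v"
  using mpoly_eval_var_mult[of v "mpoly_const 1" a]
  using mpoly_eval_const[of 1 a] by (simp add: mpoly_const_def)

section \<open>Ideals and their zero sets\<close>

lemma mpoly_eval_eq_0_if_ideal_generated:
  assumes "p \<in> ideal_generated F" "\<And>q. q \<in> F \<Longrightarrow> mpoly_eval q a = 0"
  shows "mpoly_eval p a = 0"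
proof -
  interpret module "(*) :: 'v mpoly \<Rightarrow> 'v mpoly \<Rightarrow> 'v mpoly"
    by unfold_locales (simp_all add: algebra_simps)
  from assms(1) have "p \<in> span F"
    by (simp add: ideal_generated_def)
  then show ?thesis
    by (induction rule: span_induct_alt) (simp_all add: mpoly_eval_add assms(2))
qed

lemma ideal_generated_superset: "F \<subseteq> ideal_generated F"
proof -
  interpret module "(*) :: 'a \<Rightarrow> 'a \<Rightarrow> 'a"
    by unfold_locales (simp_all add: algebra_simps)
  show ?thesis
    by (simp add: ideal_generated_def span_superset)
qed

text \<open>Any polynomials that cut out \<open>X\<close> lie in its vanishing ideal, hence are
  combinations of members of \<open>F\<close>; so they vanish at every common zero of
  \<open>F\<close>.\<close>

lemma zariski_closed_eq_zeros:
  assumes "zariski_closed X" "ideal_generated F = vanishing_ideal X"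
  shows "X = {a. \<forall>p\<in>F. mpoly_eval p a = 0}"
proof -
  obtain S where S: "X = {a. \<forall>p\<in>S. mpoly_eval p a = 0}"
    using assms(1) by (auto simp: zariski_closed_def)
  have "S \<subseteq> ideal_generated F"
    unfolding assms(2) S vanishing_ideal_def by blast
  moreover have "F \<subseteq> vanishing_ideal X"
    using ideal_generated_superset assms(2) by blast
  ultimately show ?thesis
    using mpoly_eval_eq_0_if_ideal_generated unfolding S vanishing_ideal_def by blast
qed


section \<open>Substitution of power series\<close>

lemma fps_nth_0_mpoly_fps:
  assumes "\<And>v. fps_nth (\<gamma> v) 0 = 0"
  shows "fps_nth (mpoly_fps p \<gamma>) 0 = mpoly_eval p 0"
  by (induction p rule: mpoly_induct) (simp_all add: mpoly_fps_add mpoly_eval_add assms)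

text \<open>The formal chain rule. In the inductive step the extra term of the product rule survives
  only for the index \<open>v = w\<close>.\<close>

lemma fps_deriv_mpoly_fps:
  "fps_deriv (mpoly_fps p \<gamma>) = (\<Sum>v\<in>UNIV. mpoly_fps (mpoly_deriv v p) \<gamma> * fps_deriv (\<gamma> v))"
proof (induction p rule: mpoly_induct)
  case (var_mult w p)
  have "(\<Sum>v\<in>UNIV. mpoly_fps (if w = v then p else 0) \<gamma> * fps_deriv (\<gamma> v)) =
      (\<Sum>v\<in>UNIV. if w = v then mpoly_fps p \<gamma> * fps_deriv (\<gamma> v) else 0)"
    by (rule sum.cong) simp_all
  also have "\<dots> = mpoly_fps p \<gamma> * fps_deriv (\<gamma> w)"
    by simp
  finally show ?case
    by (simp add: var_mult mpoly_fps_add distrib_right sum.distrib sum_distrib_left mult.left_commute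
          mult.assoc mult.commute[of "fps_deriv (\<gamma> w)"])
qed (simp_all add: mpoly_fps_add mpoly_deriv_add distrib_right sum.distrib)

lemma mpoly_fps_compose:
  assumes "fps_nth g 0 = 0"
  shows "mpoly_fps p (\<lambda>v. H v oo g) = mpoly_fps p H oo g"
  by (induction p rule: mpoly_induct)
     (simp_all add: mpoly_fps_add fps_compose_add_distrib fps_compose_mult_distrib[OF assms])

text \<open>A first-order Taylor expansion: changing the argument by order \<open>d\<close> changes
  the value by order \<open>d\<close>, and the leading coefficient of the change is the differential
  of \<open>p\<close> at 0 applied to the leading coefficients \<open>e v\<close>. For
  \<open>d = 0\<close> it matters that the perturbed tuple also starts at 0.\<close>

lemma mpoly_fps_perturb:
  assumes "\<And>v. fps_nth (\<delta> v) 0 = 0" "\<And>v. fps_nth (\<delta> v + fps_X ^ d * e v) 0 = 0"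
  shows "\<exists>q. mpoly_fps p (\<lambda>v. \<delta> v + fps_X ^ d * e v) = mpoly_fps p \<delta> + fps_X ^ d * q \<and>
             fps_nth q 0 = (\<Sum>v\<in>UNIV. mpoly_eval (mpoly_deriv v p) 0 * fps_nth (e v) 0)"
proof (induction p rule: mpoly_induct)
  case (const c)
  show ?case by (rule exI[of _ 0]) simp
next
  case (add p1 p2)
  then obtain q1 q2 where
    "mpoly_fps p1 (\<lambda>v. \<delta> v + fps_X ^ d * e v) = mpoly_fps p1 \<delta> + fps_X ^ d * q1"
    "fps_nth q1 0 = (\<Sum>v\<in>UNIV. mpoly_eval (mpoly_deriv v p1) 0 * fps_nth (e v) 0)"
    "mpoly_fps p2 (\<lambda>v. \<delta> v + fps_X ^ d * e v) = mpoly_fps p2 \<delta> + fps_X ^ d * q2"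
    "fps_nth q2 0 = (\<Sum>v\<in>UNIV. mpoly_eval (mpoly_deriv v p2) 0 * fps_nth (e v) 0)"
    by blast
  then show ?case
    by (intro exI[of _ "q1 + q2"])
       (simp add: mpoly_fps_add mpoly_deriv_add mpoly_eval_add algebra_simps sum.distrib)
next
  case (var_mult w p)
  let ?\<epsilon> = "\<lambda>v. \<delta> v + fps_X ^ d * e v"
  obtain q where q: "mpoly_fps p ?\<epsilon> = mpoly_fps p \<delta> + fps_X ^ d * q"
    using var_mult by blast
  \<comment> \<open>At 0 the product rule loses the term containing \<open>mpoly_deriv v p\<close>,
    as its factor \<open>mpoly_var w\<close> vanishes there. Likewise \<open>\<delta> w * q\<close>
    has no constant term below.\<close>
  have "(\<Sum>v\<in>UNIV. mpoly_eval (mpoly_deriv v (mpoly_var w * p)) 0 * fps_nth (e v) 0) =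
      (\<Sum>v\<in>UNIV. if w = v then mpoly_eval p 0 * fps_nth (e v) 0 else 0)"
    by (rule sum.cong) (simp_all add: mpoly_eval_add)
  also have "\<dots> = mpoly_eval p 0 * fps_nth (e w) 0"
    by simp
  also have "mpoly_eval p 0 = fps_nth (mpoly_fps p ?\<epsilon>) 0"
    using assms(2) by (intro fps_nth_0_mpoly_fps[symmetric])
  finally have "fps_nth (e w * mpoly_fps p ?\<epsilon> + \<delta> w * q) 0 =
      (\<Sum>v\<in>UNIV. mpoly_eval (mpoly_deriv v (mpoly_var w * p)) 0 * fps_nth (e v) 0)"
    by (simp add: assms(1) mult.commute)
  moreover have "mpoly_fps (mpoly_var w * p) ?\<epsilon> =
      mpoly_fps (mpoly_var w * p) \<delta> + fps_X ^ d * (e w * mpoly_fps p ?\<epsilon> + \<delta> w * q)"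
  proof -
    have "\<delta> w * mpoly_fps p ?\<epsilon> = \<delta> w * mpoly_fps p \<delta> + fps_X ^ d * (\<delta> w * q)"
      unfolding q by (simp only: distrib_left mult.left_commute)
    then show ?thesis
      by (simp only: mpoly_fps_var_mult distrib_left distrib_right mult.assoc add.assoc add.commute
            add.left_commute)
  qed
  ultimately show ?case by blast
qed

text \<open>The uniqueness half of the formal implicit function theorem. At the lowest order
  \<open>d\<close> where two solutions differ, the difference of their coefficients is a kernel
  vector of the Jacobian with vanishing coordinate \<open>o'\<close>, hence 0.\<close>

lemma mpoly_fps_solution_unique:
  fixes P :: "'i \<Rightarrow> 'v::finite mpoly"
  assumes ker: "\<And>u :: complex ^ 'v. u $ o' = 0 \<Longrightarrow>
        (\<And>j. (\<Sum>v\<in>UNIV. gradient (P j) 0 $ v * u $ v) = 0) \<Longrightarrow> u = 0"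
    and \<gamma>: "\<And>v. fps_nth (\<gamma> v) 0 = 0" "\<And>j. mpoly_fps (P j) \<gamma> = 0"
    and \<delta>: "\<And>v. fps_nth (\<delta> v) 0 = 0" "\<And>j. mpoly_fps (P j) \<delta> = 0"
    and eq: "\<gamma> o' = \<delta> o'"
  shows "\<gamma> = \<delta>"
proof (rule ccontr)
  assume "\<gamma> \<noteq> \<delta>"
  then have "\<exists>d v. fps_nth (\<gamma> v) d \<noteq> fps_nth (\<delta> v) d"
    by (auto simp: fun_eq_iff fps_eq_iff)
  define d where "d = (LEAST d. \<exists>v. fps_nth (\<gamma> v) d \<noteq> fps_nth (\<delta> v) d)"
  obtain w where w: "fps_nth (\<gamma> w) d \<noteq> fps_nth (\<delta> w) d"
    using LeastI_ex[OF \<open>\<exists>d v. fps_nth (\<gamma> v) d \<noteq> fps_nth (\<delta> v) d\<close>] unfolding d_def by blast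
  have below: "fps_nth (\<gamma> v) i = fps_nth (\<delta> v) i" if "i < d" for i v
    using not_less_Least[OF that[unfolded d_def]] by blast
  \<comment> \<open>The difference divided by \<open>fps_X ^ d\<close>; the division is exact
    because all lower coefficients agree.\<close>
  define e where "e v = fps_shift d (\<gamma> v - \<delta> v)" for v
  have \<gamma>_eq: "\<gamma> = (\<lambda>v. \<delta> v + fps_X ^ d * e v)"
    by (auto simp: fun_eq_iff fps_eq_iff e_def fps_X_power_mult_nth below)
  then have \<gamma>': "fps_nth (\<delta> v + fps_X ^ d * e v) 0 = 0" for v
    using \<gamma>(1)[of v] by (simp add: fun_eq_iff)
  define u :: "complex ^ 'v" where "u = (\<chi> v. fps_nth (e v) 0)"
  have "u = 0"
  proof (rule ker)
    show "u $ o' = 0"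
      by (simp add: u_def e_def eq)
    show "(\<Sum>v\<in>UNIV. gradient (P j) 0 $ v * u $ v) = 0" for j
    proof -
      obtain q where q: "mpoly_fps (P j) \<gamma> = mpoly_fps (P j) \<delta> + fps_X ^ d * q"
          "fps_nth q 0 = (\<Sum>v\<in>UNIV. mpoly_eval (mpoly_deriv v (P j)) 0 * fps_nth (e v) 0)"
        using mpoly_fps_perturb[where \<delta> = \<delta> and e = e, OF \<delta>(1) \<gamma>', of "P j"] unfolding \<gamma>_eq[symmetric] by blast
      \<comment> \<open>Both tuples solve \<open>P j\<close>, so \<open>fps_X ^ d * q = 0\<close>.
        The constant term of \<open>q\<close> is then the kernel equation for
        \<open>u\<close>.\<close>
      from q(1) have "q = 0"
        by (simp add: \<gamma>(2) \<delta>(2))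
      with q(2) show ?thesis
        by (simp add: gradient_def u_def)
    qed
  qed
  then have "fps_nth (e w) 0 = 0"
    by (simp add: u_def vec_eq_iff)
  with w show False
    by (simp add: e_def)
qed

section \<open>Formal substitution along a parametrization\<close>

lemma fps_nth_power_eq_0:
  fixes g :: "'a::comm_ring_1 fps"
  assumes "fps_nth g 0 = 0" "k < n"
  shows "fps_nth (g ^ n) k = 0"
  using assms startsby_zero_power_prefix by blast

text \<open>Every \<open>\<gamma> v\<close> is divisible by t, so a monomial of total degree N has
  order at least N. In the convolution, either the first factor has too small an index or the
  remaining product does.\<close>

lemma fps_nth_prod_power_eq_0:
  fixes \<gamma> :: "'v \<Rightarrow> 'a::comm_ring_1 fps"
  assumes "finite A" "\<And>v. fps_nth (\<gamma> v) 0 = 0" "k < (\<Sum>v\<in>A. m v)"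
  shows "fps_nth (\<Prod>v\<in>A. \<gamma> v ^ m v) k = 0"
  using assms(1,3)
proof (induction A arbitrary: k)
  case (insert a A)
  have "fps_nth (\<gamma> a ^ m a) i * fps_nth (\<Prod>v\<in>A. \<gamma> v ^ m v) (k - i) = 0" if "i \<le> k" for i
  proof (cases "i < m a")
    case True
    then show ?thesis by (simp add: fps_nth_power_eq_0 assms(2))
  next
    case False
    then have "k - i < sum m A"
      using insert.prems insert.hyps that by auto
    then show ?thesis by (simp add: insert.IH)
  qed
  then show ?case
    using insert.hyps by (simp add: fps_mult_nth)
qed simp

text \<open>One sum runs over the monomials of degree at most \<open>k\<close>, the other over the
  support of \<open>p\<close>. Monomials in only one index set contribute 0: their coefficient is 0
  or their order exceeds \<open>k\<close>.\<close>

lemma mfps_subst_mpoly: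
  fixes \<gamma> :: "'v::finite \<Rightarrow> complex fps"
  assumes "\<And>v. fps_nth (\<gamma> v) 0 = 0"
  shows "mfps_subst (mfps_of_mpoly p) \<gamma> = mpoly_fps p \<gamma>"
proof (rule fps_ext)
  fix k
  let ?M = "{m :: 'v \<Rightarrow>\<^sub>0 nat. (\<Sum>v\<in>UNIV. Poly_Mapping.lookup m v) \<le> k}"
  have "finite ?M"
  proof (rule finite_subset[OF _ finite_le_poly_mapping])
    show "?M \<subseteq> {m. \<forall>v. Poly_Mapping.lookup m v \<le> k}"
    proof clarify
      fix m :: "'v \<Rightarrow>\<^sub>0 nat" and v
      assume "(\<Sum>v\<in>UNIV. Poly_Mapping.lookup m v) \<le> k"
      moreover have "Poly_Mapping.lookup m v \<le> (\<Sum>v\<in>UNIV. Poly_Mapping.lookup m v)"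
        by (rule member_le_sum) auto
      ultimately show "Poly_Mapping.lookup m v \<le> k" by simp
    qed
  qed
  then have "fps_nth (mfps_subst (mfps_of_mpoly p) \<gamma>) k =
      (\<Sum>m\<in>Poly_Mapping.keys p. Poly_Mapping.lookup p m *
         fps_nth (\<Prod>v\<in>UNIV. \<gamma> v ^ Poly_Mapping.lookup m v) k)"
    unfolding mfps_subst_def mfps_of_mpoly_def mfps_coeff_Abs fps_nth_Abs_fps
    by (intro sum.mono_neutral_cong)
       (auto simp: in_keys_iff not_le intro!: fps_nth_prod_power_eq_0 assms)
  then show "fps_nth (mfps_subst (mfps_of_mpoly p) \<gamma>) k = fps_nth (mpoly_fps p \<gamma>) k"
    by (simp add: mpoly_fps_def fps_sum_nth)
qed

text \<open>This is well-definedness of the substitution map, applied to \<open>p\<close> and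
  0.\<close>

lemma mpoly_fps_parametrization:
  assumes "parametrization X \<gamma>" "p \<in> vanishing_ideal X"
  shows "mpoly_fps p \<gamma> = 0"
proof -
  have "mfps_of_mpoly p - 0 \<in> ideal_generated (mfps_of_mpoly ` vanishing_ideal X)"
    using assms(2) ideal_generated_superset[of "mfps_of_mpoly ` vanishing_ideal X"] by auto
  then have "mfps_subst (mfps_of_mpoly p) \<gamma> = mfps_subst 0 \<gamma>"
    using assms(1) unfolding parametrization_def by blast
  moreover have "mfps_of_mpoly 0 = (0 :: 'a mfps)"
    by (rule mfps_eqI) (simp add: mfps_of_mpoly_def zero_mfps_def)
  ultimately show ?thesis
    using assms(1) mfps_subst_mpoly[of \<gamma>] unfolding parametrization_def
    by (metis mpoly_fps_0)
qed

section \<open>The implicit function theorem\<close>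

text \<open>The vectors of \<open>B\<close> span a space of codimension 1, so their common annihilator is spanned by \<open>w\<close>.\<close>

lemma annihilator_of_hyperplane_family:
  fixes B :: "(complex ^ 'v::finite) set" and u w :: "complex ^ 'v"
  assumes "vec.independent B" and card: "Suc (card B) = CARD('v)"
    and w: "\<And>b. b \<in> B \<Longrightarrow> (\<Sum>v\<in>UNIV. b $ v * w $ v) = 0" and "w $ o' = 1"
    and u: "\<And>b. b \<in> B \<Longrightarrow> (\<Sum>v\<in>UNIV. b $ v * u $ v) = 0" and "u $ o' = 0"
  shows "u = 0"
proof (rule ccontr)
  assume "u \<noteq> 0"
  then obtain i where i: "u $ i \<noteq> 0"
    by (auto simp: vec_eq_iff)
  define pair where "pair b w = (\<Sum>v\<in>UNIV. b $ v * w $ v)" for b w :: "complex ^ 'v"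
  have span: "pair b z = 0" if "b \<in> vec.span S" "\<And>b. b \<in> S \<Longrightarrow> pair b z = 0" for b z S
    using that(1)
    by (induction rule: vec.span_induct_alt)
       (simp_all add: that(2) pair_def distrib_right sum.distrib mult.assoc flip: sum_distrib_left,
        simp_all add: that(2) flip: pair_def)
  have pair_axis: "pair (axis k 1) z = z $ k" for k z
    by (simp add: pair_def axis_def if_distrib[of "\<lambda>x. x * _"] cong: if_cong)
  \<comment> \<open>Subtracting a multiple of \<open>u\<close> kills coordinate \<open>i\<close> of
    \<open>w\<close>. Coordinate \<open>o'\<close> stays 1 because \<open>u $ o' = 0\<close>, so
    \<open>w'\<close> separates \<open>axis o' 1\<close> from the span of \<open>axis i 1\<close>
    and \<open>B\<close>.\<close>
  define w' where "w' = w - (w $ i / u $ i) *s u"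
  have w': "pair b w' = pair b w - (w $ i / u $ i) * pair b u" for b
    by (simp add: w'_def pair_def algebra_simps sum_subtractf sum_distrib_left)
  have "axis i 1 \<notin> vec.span B"
    using span[of "axis i 1" B u] u i by (auto simp: pair_axis) (simp add: pair_def)
  moreover have "axis o' 1 \<notin> vec.span (insert (axis i 1) B)"
  proof
    assume "axis o' 1 \<in> vec.span (insert (axis i 1) B)"
    then have "pair (axis o' 1) w' = 0"
    proof (rule span)
      fix b assume "b \<in> insert (axis i 1) B"
      then show "pair b w' = 0"
        using i u w by (auto simp: w' pair_axis) (simp add: pair_def)
    qed
    then show False
      using assms(4,6) by (simp add: w' pair_axis)
  qed
  ultimately have ind: "vec.independent (insert (axis o' 1) (insert (axis i 1) B))"
    using assms(1) by (meson vec.independent_insertI)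
  have "axis i 1 \<notin> B" "axis o' 1 \<notin> insert (axis i 1) B"
    using \<open>axis i 1 \<notin> vec.span B\<close> \<open>axis o' 1 \<notin> vec.span (insert (axis i 1) B)\<close> vec.span_base by blast+
  \<comment> \<open>These are \<open>CARD('v) + 1\<close> independent vectors, one more than the
    dimension allows.\<close>
  then have "card (insert (axis o' 1) (insert (axis i 1) B)) = card B + 2"
    using vec.finiteI_independent[OF assms(1)] by simp
  moreover have "card (insert (axis o' 1) (insert (axis i 1) B)) \<le> CARD('v)"
    using vec.independent_card_le_dim[OF _ ind, of UNIV] by (simp add: card_cart_basis)
  ultimately show False
    using card by simp
qed

section \<open>Polynomial maps as analytic maps\<close>

lemma continuous_on_mpoly_eval [continuous_intros]:
  "continuous_on A (\<lambda>a. mpoly_eval p a)"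
  unfolding mpoly_eval_def by (intro continuous_intros)

text \<open>The derivative is taken over the reals, as the inverse function theorem requires; the
  formula shows that it is complex-linear.\<close>

lemma has_derivative_mpoly_eval:
  "(mpoly_eval p has_derivative (\<lambda>u. \<Sum>v\<in>UNIV. gradient p a $ v * u $ v)) (at a)"
proof (induction p rule: mpoly_induct)
  case (const c)
  show ?case by (simp add: gradient_def)
next
  case (add p q)
  from has_derivative_add[OF this] show ?case
    by (simp add: gradient_def mpoly_deriv_add mpoly_eval_add distrib_right sum.distrib)
next
  case (var_mult w p)
  have "(\<Sum>v\<in>UNIV. gradient (mpoly_var w * p) a $ v * u $ v) =
      a $ w * (\<Sum>v\<in>UNIV. gradient p a $ v * u $ v) + u $ w * mpoly_eval p a" for u
  proof -
    have "(\<Sum>v\<in>UNIV. gradient (mpoly_var w * p) a $ v * u $ v) =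
        (\<Sum>v\<in>UNIV. a $ w * (gradient p a $ v * u $ v) + (if w = v then mpoly_eval p a * u $ v else 0))"
      by (rule sum.cong) (simp_all add: gradient_def mpoly_eval_add distrib_right mult.assoc)
    then show ?thesis
      by (simp add: sum.distrib mult.commute[of "u $ w"] flip: sum_distrib_left)
  qed
  moreover have "((\<lambda>a. a $ w * mpoly_eval p a) has_derivative
      (\<lambda>u. a $ w * (\<Sum>v\<in>UNIV. gradient p a $ v * u $ v) + u $ w * mpoly_eval p a)) (at a)"
    by (intro has_derivative_mult var_mult bounded_linear_imp_has_derivative bounded_linear_vec_nth)
  ultimately show ?case by simp
qed

text \<open>The bridge between formal substitution and analytic composition: identities of series
  become identities of functions near 0, and conversely.\<close>

lemma has_fps_expansion_mpoly_eval:
  fixes \<phi> :: "complex \<Rightarrow> complex ^ 'v::finite"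
  assumes "\<And>v. (\<lambda>x. \<phi> x $ v) has_fps_expansion H v"
  shows "(\<lambda>x. mpoly_eval p (\<phi> x)) has_fps_expansion mpoly_fps p H"
  by (induction p rule: mpoly_induct)
     (simp_all add: mpoly_eval_add mpoly_fps_add assms has_fps_expansion_add has_fps_expansion_mult)

text \<open>Row \<open>None\<close> is the gradient of the coordinate x, so this square matrix is
  the Jacobian matrix of \<open>mpoly_straighten P\<close>.\<close>

definition mpoly_jacobian ::
    "('n::finite \<Rightarrow> 'n option mpoly) \<Rightarrow> complex ^ 'n option \<Rightarrow> complex ^ 'n option ^ 'n option" where
  "mpoly_jacobian P a = (\<chi> i v. case i of None \<Rightarrow> if v = None then 1 else 0 | Some j \<Rightarrow> gradient (P j) a $ v)"

text \<open>Where the Jacobian is invertible these are local coordinates in which the zero set of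
  all \<open>P j\<close> becomes the x-axis.\<close>

definition mpoly_straighten ::
    "('n::finite \<Rightarrow> 'n option mpoly) \<Rightarrow> complex ^ 'n option \<Rightarrow> complex ^ 'n option" where
  "mpoly_straighten P a = (\<chi> i. case i of None \<Rightarrow> a $ None | Some j \<Rightarrow> mpoly_eval (P j) a)"

lemma mpoly_jacobian_mult:
  "mpoly_jacobian P a *v u =
     (\<chi> i. case i of None \<Rightarrow> u $ None | Some j \<Rightarrow> \<Sum>v\<in>UNIV. gradient (P j) a $ v * u $ v)"
  by (auto simp: vec_eq_iff mpoly_jacobian_def matrix_vector_mult_def if_distrib[of "\<lambda>x. x * _"]
        split: option.split cong: if_cong)

text \<open>Pulls a property of all small x back to all points near the origin.\<close>

lemma filterlim_vec_nth_0: "filterlim (\<lambda>a :: complex ^ 'v. a $ i) (nhds 0) (nhds 0)"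
proof -
  have "((\<lambda>a :: complex ^ 'v. a $ i) \<longlongrightarrow> 0 $ i) (nhds 0)"
    by (intro tendsto_vec_nth filterlim_ident)
  then show ?thesis by simp
qed

lemma has_derivative_vec_lambda:
  fixes f :: "'a::real_normed_vector \<Rightarrow> 'i::finite \<Rightarrow> 'b::euclidean_space"
  assumes "\<And>i. ((\<lambda>x. f x i) has_derivative (\<lambda>h. f' h i)) (at a within S)"
  shows "((\<lambda>x. \<chi> i. f x i) has_derivative (\<lambda>h. \<chi> i. f' h i)) (at a within S)"
  unfolding has_derivative_componentwise_within[of "\<lambda>x. \<chi> i. f x i"]
  by (auto simp: Basis_vec_def inner_axis intro!: has_derivative_inner_left assms)

text \<open>The inverse function theorem is applied to the straightening map. The preimage of the
  x-axis is the graph; once the inverse is seen to be holomorphic along that axis, its coordinates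
  expand into the convergent series \<open>h j\<close>.\<close>

lemma implicit_curve:
  fixes P :: "'n::finite \<Rightarrow> 'n option mpoly"
  assumes zero: "\<And>j. mpoly_eval (P j) 0 = 0"
    and ker: "\<And>u :: complex ^ 'n option. u $ None = 0 \<Longrightarrow>
        (\<And>j. (\<Sum>v\<in>UNIV. gradient (P j) 0 $ v * u $ v) = 0) \<Longrightarrow> u = 0"
  obtains h :: "'n \<Rightarrow> complex fps" where
    "\<And>j. fps_conv_radius (h j) > 0" "\<And>j. fps_nth (h j) 0 = 0"
    "\<And>j. mpoly_fps (P j) (case_option fps_X h) = 0"
    "\<forall>\<^sub>F a in nhds 0. (\<forall>j. mpoly_eval (P j) a = 0) \<longrightarrow> (\<forall>j. a $ Some j = eval_fps (h j) (a $ None))"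
proof -
  let ?J = "\<lambda>a. (*v) (mpoly_jacobian P a)"
  define F where "F a = Blinfun (?J a)" for a
  have F: "blinfun_apply (F a) = ?J a" for a
    unfolding F_def by (intro bounded_linear_Blinfun_apply linear_conv_bounded_linear[THEN iffD1] matrix_vector_mul_linear)
  have deriv: "(mpoly_straighten P has_derivative F a) (at a)" for a
  proof -
    have "((\<lambda>a. case i of None \<Rightarrow> a $ None | Some j \<Rightarrow> mpoly_eval (P j) a) has_derivative
        (\<lambda>u. case i of None \<Rightarrow> u $ None | Some j \<Rightarrow> \<Sum>v\<in>UNIV. gradient (P j) a $ v * u $ v)) (at a)" for i
      by (cases i)
         (auto intro!: has_derivative_mpoly_eval bounded_linear_imp_has_derivative bounded_linear_vec_nth)
    then show ?thesis
      unfolding F mpoly_jacobian_mult mpoly_straighten_def[abs_def] by (rule has_derivative_vec_lambda)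
  qed
  have cont: "continuous_on UNIV F"
  proof (rule continuous_on_blinfun_componentwise)
    fix u :: "complex ^ 'n option"
    have "continuous_on UNIV (\<lambda>a. case i of None \<Rightarrow> u $ None
        | Some j \<Rightarrow> \<Sum>v\<in>UNIV. gradient (P j) a $ v * u $ v)" for i
      by (cases i) (auto simp: gradient_def intro!: continuous_intros)
    then show "continuous_on UNIV (\<lambda>a. blinfun_apply (F a) u)"
      unfolding F mpoly_jacobian_mult by (intro continuous_intros)
  qed
  have "inj (?J 0)"
  proof (subst linear_injective_0)
    show "\<forall>u. mpoly_jacobian P 0 *v u = 0 \<longrightarrow> u = 0"
    proof (intro allI impI)
      fix u :: "complex ^ 'n option"
      assume *: "mpoly_jacobian P 0 *v u = 0"
      have "(mpoly_jacobian P 0 *v u) $ i = 0" for i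
        by (simp add: *)
      from this[of None] this[of "Some _"] show "u = 0"
        by (intro ker) (simp_all add: mpoly_jacobian_mult)
    qed
  qed simp
  \<comment> \<open>The inverse function theorem asks for a left inverse of the derivative; in
    finite dimension injectivity supplies one.\<close>
  then obtain L where L: "linear L" "L \<circ> ?J 0 = id"
    using linear_injective_left_inverse[OF matrix_vector_mul_linear] by blast
  have "Blinfun L o\<^sub>L F 0 = id_blinfun"
    using L(2) bounded_linear_Blinfun_apply[OF linear_conv_bounded_linear[THEN iffD1, OF L(1)]]
    by (intro blinfun_eqI) (simp add: F fun_eq_iff)
  then obtain U V g g' where U: "open U" "0 \<in> U" and V: "open V" "mpoly_straighten P 0 \<in> V"
    and hom: "homeomorphism U V (mpoly_straighten P) g"
    and g: "\<And>y. y \<in> V \<Longrightarrow> (g has_derivative g' y) (at y)"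
    and g': "\<And>y. y \<in> V \<Longrightarrow> g' y = inv (?J (g y))" "\<And>y. y \<in> V \<Longrightarrow> bij (?J (g y))"
    using inverse_function_theorem[OF open_UNIV deriv cont UNIV_I] unfolding F by metis
  have at_0: "mpoly_straighten P 0 = 0"
    by (simp add: mpoly_straighten_def vec_eq_iff zero split: option.split)
  \<comment> \<open>The point of the zero set above x, as the image of the axis under the local
    inverse.\<close>
  define \<psi> where "\<psi> x = g (axis None x)" for x
  have "0 \<in> V"
    using V at_0 by simp
  have \<psi>0: "\<psi> 0 = 0"
    using homeomorphism_apply1[OF hom U(2)] at_0 by (simp add: \<psi>_def axis_def zero_vec_def)
  define W where "W = {x. axis None x \<in> V}"
  have axis_linear: "bounded_linear (axis None :: complex \<Rightarrow> complex ^ 'n option)"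
    unfolding linear_conv_bounded_linear[symmetric] by (rule linearI) (auto simp: axis_def vec_eq_iff)
  then have axis_cont: "continuous_on UNIV (axis None :: complex \<Rightarrow> complex ^ 'n option)"
    by (rule linear_continuous_on)
  have "open W"
    unfolding W_def using open_vimage[OF V(1) axis_cont] by (simp add: vimage_def)
  have "0 \<in> W"
    using \<open>0 \<in> V\<close> by (simp add: W_def axis_def zero_vec_def)
  have straighten: "mpoly_straighten P (\<psi> x) = axis None x" if "x \<in> W" for x
    using that homeomorphism_apply2[OF hom] by (simp add: W_def \<psi>_def)
  have \<psi>_None: "\<psi> x $ None = x" if "x \<in> W" for x
    using arg_cong[OF straighten[OF that], of "\<lambda>a. a $ None"]
    by (simp add: mpoly_straighten_def axis_def)
  have \<psi>_P: "mpoly_eval (P j) (\<psi> x) = 0" if "x \<in> W" for x j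
    using arg_cong[OF straighten[OF that], of "\<lambda>a. a $ Some j"]
    by (simp add: mpoly_straighten_def axis_def)
  have holo: "(\<lambda>x. \<psi> x $ i) holomorphic_on W" for i
  proof (rule holomorphic_onI)
    fix x assume "x \<in> W"
    then have xV: "axis None x \<in> V"
      by (simp add: W_def)
    define A where "A = mpoly_jacobian P (\<psi> x)"
    have A: "g' (axis None x) = inv ((*v) A)" "bij ((*v) A)"
      using g'[OF xV] by (simp_all add: \<psi>_def A_def)
    from has_derivative_compose[OF bounded_linear_imp_has_derivative[OF axis_linear] g[OF xV]]
    have "(\<psi> has_derivative (\<lambda>t. inv ((*v) A) (axis None t))) (at x)"
      unfolding \<psi>_def[abs_def] A(1) .
    then have deriv_i: "((\<lambda>x. \<psi> x $ i) has_derivative (\<lambda>t. inv ((*v) A) (axis None t) $ i)) (at x)"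
      by (rule bounded_linear.has_derivative[OF bounded_linear_vec_nth])
    \<comment> \<open>So far the derivative is only real. The inverse of a complex-linear bijection
      is complex-linear, so along the axis it is multiplication by \<open>c $ i\<close>, which is
      complex differentiability.\<close>
    define c where "c = inv ((*v) A) (axis None 1)"
    have inv_A: "inv ((*v) A) (axis None t) = t *s c" for t
      unfolding c_def
    proof (rule inv_f_eq[OF bij_is_inj[OF A(2)]])
      have "A *v (t *s inv ((*v) A) (axis None 1)) = t *s axis None 1"
        unfolding vector_scalar_commute surj_f_inv_f[OF bij_is_surj[OF A(2)]] by (rule refl)
      also have "\<dots> = axis None t"
        by (simp add: axis_def vec_eq_iff)
      finally show "A *v (t *s inv ((*v) A) (axis None 1)) = axis None t" .
    qed
    from deriv_i have "((\<lambda>x. \<psi> x $ i) has_derivative (*) (c $ i)) (at x)"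
      by (simp only: inv_A vector_smult_component mult.commute[of _ "c $ i"])
    then have "((\<lambda>x. \<psi> x $ i) has_field_derivative c $ i) (at x)"
      by (simp only: has_field_derivative_def)
    then show "(\<lambda>x. \<psi> x $ i) field_differentiable at x within W"
      unfolding field_differentiable_def by (blast intro: has_field_derivative_at_within)
  qed
  define h where "h j = fps_expansion (\<lambda>x. \<psi> x $ Some j) 0" for j
  have h: "(\<lambda>x. \<psi> x $ Some j) has_fps_expansion h j" for j
    unfolding h_def by (rule has_fps_expansion_fps_expansion[OF \<open>open W\<close> \<open>0 \<in> W\<close> holo])
  have W_ev: "\<forall>\<^sub>F x in nhds 0. x \<in> W"
    using \<open>open W\<close> \<open>0 \<in> W\<close> by (rule eventually_nhds_in_open)
  have exp: "(\<lambda>x. \<psi> x $ v) has_fps_expansion (case_option fps_X h) v" for v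
  proof (cases v)
    case None
    have "(\<lambda>x. \<psi> x $ None) has_fps_expansion fps_X \<longleftrightarrow> (\<lambda>x. x) has_fps_expansion (fps_X :: complex fps)"
      using W_ev by (intro has_fps_expansion_cong) (auto elim!: eventually_mono simp: \<psi>_None)
    with None show ?thesis
      by (simp add: has_fps_expansion_fps_X)
  qed (simp add: h)
  show ?thesis
  proof (rule that)
    show "fps_conv_radius (h j) > 0" for j
      using h by (simp add: has_fps_expansion_def)
    show "fps_nth (h j) 0 = 0" for j
      using has_fps_expansion_imp_0_eq_fps_nth_0[OF h[of j]] \<psi>0 by simp
    show "mpoly_fps (P j) (case_option fps_X h) = 0" for j
    proof -
      have "(\<lambda>x. mpoly_eval (P j) (\<psi> x)) has_fps_expansion mpoly_fps (P j) (case_option fps_X h)"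
        by (rule has_fps_expansion_mpoly_eval[OF exp])
      moreover have "(\<lambda>x. mpoly_eval (P j) (\<psi> x)) has_fps_expansion 0"
        unfolding has_fps_expansion_0_iff using W_ev by (rule eventually_mono) (simp add: \<psi>_P)
      ultimately show ?thesis
        by (rule fps_expansion_unique_complex)
    qed
    have "\<forall>\<^sub>F x in nhds 0. \<forall>j. eval_fps (h j) x = \<psi> x $ Some j"
      using h by (intro eventually_all_finite) (simp add: has_fps_expansion_def)
    from eventually_compose_filterlim[OF this filterlim_vec_nth_0]
        have "\<forall>\<^sub>F a in nhds (0 :: complex ^ 'n option). \<forall>j. eval_fps (h j) (a $ None) = \<psi> (a $ None) $ Some j" .
    moreover have "\<forall>\<^sub>F a in nhds 0. a \<in> U"
      using U by (rule eventually_nhds_in_open)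
    ultimately show "\<forall>\<^sub>F a in nhds 0. (\<forall>j. mpoly_eval (P j) a = 0) \<longrightarrow>
        (\<forall>j. a $ Some j = eval_fps (h j) (a $ None))"
    proof eventually_elim
      case (elim a)
      show ?case
      proof
        assume "\<forall>j. mpoly_eval (P j) a = 0"
        \<comment> \<open>A zero in \<open>U\<close> is straightened to a point of the axis, and the
          local inverse brings it back to \<open>a\<close>.\<close>
        then have "mpoly_straighten P a = axis None (a $ None)"
          by (auto simp: mpoly_straighten_def axis_def vec_eq_iff split: option.split)
        then have "\<psi> (a $ None) = a"
          using homeomorphism_apply1[OF hom elim(2)] by (simp add: \<psi>_def)
        with elim(1) show "\<forall>j. a $ Some j = eval_fps (h j) (a $ None)"
          by simp
      qed
    qed
  qed
qed

text \<open>Along the graph map \<open>\<phi>\<close> the polynomial has expansion 0, so it vanishes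
  for small x; a point \<open>a\<close> of the graph equals
  \<open>\<phi> (a $ None)\<close>.\<close>

lemma eventually_mpoly_eval_graph:
  fixes h :: "'n::finite \<Rightarrow> complex fps"
  assumes "\<And>j. fps_conv_radius (h j) > 0" "mpoly_fps p (case_option fps_X h) = 0"
  shows "\<forall>\<^sub>F a in nhds 0. (\<forall>j. a $ Some j = eval_fps (h j) (a $ None)) \<longrightarrow> mpoly_eval p a = 0"
proof -
  define \<phi> :: "complex \<Rightarrow> complex ^ 'n option"
    where "\<phi> x = (\<chi> v. case v of None \<Rightarrow> x | Some j \<Rightarrow> eval_fps (h j) x)" for x
  have "(\<lambda>x. \<phi> x $ v) has_fps_expansion (case_option fps_X h) v" for v
    using assms(1)
    by (cases v) (simp_all add: \<phi>_def has_fps_expansion_fps_X eval_fps_has_fps_expansion)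
  from has_fps_expansion_mpoly_eval[of \<phi>, OF this, of p]
  have "\<forall>\<^sub>F x in nhds 0. mpoly_eval p (\<phi> x) = 0"
    by (simp add: assms(2) has_fps_expansion_0_iff)
  from eventually_compose_filterlim[OF this filterlim_vec_nth_0]
  have "\<forall>\<^sub>F a in nhds (0 :: complex ^ 'n option). mpoly_eval p (\<phi> (a $ None)) = 0" .
  then show ?thesis
  proof eventually_elim
    case (elim a)
    have "\<phi> (a $ None) = a" if "\<forall>j. a $ Some j = eval_fps (h j) (a $ None)"
      using that by (auto simp: \<phi>_def vec_eq_iff split: option.split)
    with elim show ?case by auto
  qed
qed

section \<open>Slopes and curvatures along a graph\<close>

text \<open>The denominator along \<open>\<gamma>\<close> has nonzero constant term and is thus a
  unit, so the quotient is a power series and constant terms can be divided.\<close>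

lemma implicit_expression_finite_at_0:
  assumes "implicit_expression F \<gamma> s e" "finite_at_0 e" "\<And>v. fps_nth (\<gamma> v) 0 = 0"
  obtains u where "s = fps_to_fls u" "fps_nth u 0 = value_at_0 e"
proof -
  let ?n = "mpoly_fps (fst e) \<gamma>" and ?d = "mpoly_fps (snd e) \<gamma>"
  have d: "fps_nth ?d 0 \<noteq> 0"
    using assms(2) by (simp add: fps_nth_0_mpoly_fps[OF assms(3)] finite_at_0_def)
  show ?thesis
  proof (rule that)
    have "s = fps_to_fls ?n / fps_to_fls ?d"
      using assms(1) by (simp add: implicit_expression_def)
    also have "\<dots> = fps_to_fls (?n / ?d)"
      using d by (intro fls_divide_fps_to_fls) (simp add: subdegree_eq_0)
    finally show "s = fps_to_fls (?n / ?d)" .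
    show "fps_nth (?n / ?d) 0 = value_at_0 e"
      using d by (simp add: fps_divide_unit value_at_0_def fps_nth_0_mpoly_fps[OF assms(3)] divide_inverse)
  qed
qed

text \<open>The chain rule produces a factor \<open>fps_deriv x\<close>, which cancels because it is
  nonzero as a series, even if its constant term is 0.\<close>

lemma slope_compose:
  assumes "fps_nth x 0 = 0" "fps_deriv x \<noteq> 0"
  shows "slope x (h oo x) = fps_to_fls (fps_deriv h oo x)"
  using assms(2) by (simp add: slope_def fps_compose_deriv[OF assms(1)] fls_times_fps_to_fls)

text \<open>Differentiating in t and dividing by \<open>fps_deriv x\<close> is differentiation in x
  along the graph. The curvature of index \<open>i + 1\<close> is therefore the derivative of order
  \<open>i + 2\<close>.\<close>

lemma curvature_compose:
  assumes "fps_nth x 0 = 0" "fps_deriv x \<noteq> 0"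
  shows "curvature x (h oo x) (Suc i) = fps_to_fls (fps_nth_deriv (i + 2) h oo x)"
proof (induction i)
  case 0
  let ?x' = "fps_deriv x"
  let ?y' = "(fps_deriv h oo x) * ?x'"
  \<comment> \<open>The terms with the second derivative of \<open>x\<close> cancel, leaving exactly
    the cube of the denominator.\<close>
  have "fps_deriv ?y' * ?x' - ?y' * fps_deriv ?x' = (fps_deriv (fps_deriv h) oo x) * ?x' ^ 3"
    by (simp add: fps_compose_deriv[OF assms(1)] algebra_simps power3_eq_cube)
  then show ?case
    using assms(2)
    by (simp add: fps_compose_deriv[OF assms(1)] fls_times_fps_to_fls fps_to_fls_power
        numeral_2_eq_2)
next
  case (Suc i)
  have "curvature x (h oo x) (Suc (Suc i)) =
      fps_to_fls (fps_deriv (fps_nth_deriv (i + 2) h oo x)) / fps_to_fls (fps_deriv x)"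
    by (simp add: Suc fls_deriv_fps_to_fls)
  also have "\<dots> = fps_to_fls (fps_deriv (fps_nth_deriv (i + 2) h) oo x)"
    using assms(2) by (simp add: fps_compose_deriv[OF assms(1)] fls_times_fps_to_fls)
  also have "fps_deriv (fps_nth_deriv (i + 2) h) = fps_nth_deriv (Suc i + 2) h"
    by (metis add_Suc fps_nth_deriv_commute)
  finally show ?case .
qed


section \<open>Convergence of the branch equations\<close>

text \<open>Strictly inside the radius the univariate series converges absolutely, so it may be
  summed in any order. Reindexing by \<open>Poly_Mapping.single v\<close> reaches the pure powers of
  \<open>v\<close>; all other monomials have coefficient 0.\<close>

lemma has_sum_mfps_of_fps:
  fixes a :: "complex ^ 'v::finite"
  assumes "ereal (norm (a $ v)) < fps_conv_radius h"
  shows "(mfps_term (mfps_of_fps v h) a has_sum eval_fps h (a $ v)) UNIV"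
proof -
  have "((\<lambda>n. fps_nth h n * (a $ v) ^ n) has_sum eval_fps h (a $ v)) UNIV"
    using assms by (intro norm_summable_imp_has_sum norm_summable_fps sums_eval_fps)
  also have "(\<lambda>n. fps_nth h n * (a $ v) ^ n) = mfps_term (mfps_of_fps v h) a \<circ> Poly_Mapping.single v"
  proof (rule ext)
    fix n
    have "(\<Prod>w\<in>UNIV. (a $ w) ^ Poly_Mapping.lookup (Poly_Mapping.single v n) w) = (a $ v) ^ n"
      by (subst prod.remove[of _ v]) (auto simp: lookup_single when_def intro!: prod.neutral)
    then show "fps_nth h n * (a $ v) ^ n = (mfps_term (mfps_of_fps v h) a \<circ> Poly_Mapping.single v) n"
      by (simp add: mfps_term_def mfps_of_fps_def)
  qed
  finally have "(mfps_term (mfps_of_fps v h) a has_sum eval_fps h (a $ v)) (range (Poly_Mapping.single v))"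
    by (rule has_sum_reindex[THEN iffD2, rotated]) simp
  then show ?thesis
  proof (subst has_sum_cong_neutral)
    fix m :: "'v \<Rightarrow>\<^sub>0 nat" assume "m \<in> UNIV - range (Poly_Mapping.single v)"
    then have "m \<noteq> Poly_Mapping.single v (Poly_Mapping.lookup m v)" by blast
    then show "mfps_term (mfps_of_fps v h) a m = 0"
      by (simp add: mfps_term_def mfps_of_fps_def)
  qed auto
qed

lemma mfps_term_diff: "mfps_term (F - G) a m = mfps_term F a m - mfps_term G a m"
  by (simp add: mfps_term_def minus_mfps_def left_diff_distrib)

lemma has_sum_var_diff_graph:
  fixes a :: "complex ^ 'v::finite"
  assumes "ereal (norm (a $ w)) < fps_conv_radius h"
  shows "(mfps_term (mfps_var v - mfps_of_fps w h) a has_sum (a $ v - eval_fps h (a $ w))) UNIV"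
proof -
  have var: "(mfps_term (mfps_var v) a has_sum a $ v) UNIV"
    using has_sum_mfps_of_fps[of a v fps_X] by (simp add: mfps_var_def)
  have "((\<lambda>m. - mfps_term (mfps_of_fps w h) a m) has_sum - eval_fps h (a $ w)) UNIV"
    using has_sum_mfps_of_fps[OF assms] by (subst has_sum_uminus) simp
  from has_sum_add[OF var this] show ?thesis
    unfolding mfps_term_diff[abs_def] by simp
qed

lemma eventually_norm_vec_nth_less:
  assumes "r > 0"
  shows "\<forall>\<^sub>F a :: complex ^ 'v in nhds 0. ereal (norm (a $ i)) < r"
proof -
  have "\<forall>\<^sub>F z :: complex in nhds 0. z \<in> eball 0 r"
    using assms by (intro eventually_nhds_in_open) (auto simp: zero_ereal_def)
  from eventually_compose_filterlim[OF this filterlim_vec_nth_0] show ?thesis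
    by simp
qed

text \<open>The hypotheses make \<open>s\<close> and \<open>k i\<close> the derivatives of
  \<open>h\<close> at 0 of orders 1 and \<open>i + 1\<close>, so the series in
  \<open>branch_equation\<close> is the Taylor series of \<open>h\<close>.\<close>

lemma branch_equation_eq:
  assumes "fps_nth h 0 = 0" "fps_nth h 1 = s" "\<And>i. i \<ge> 1 \<Longrightarrow> fact (i + 1) * fps_nth h (i + 1) = k i"
  shows "branch_equation j s k = mfps_var (Some j) - mfps_of_fps None h"
proof -
  have "fps_const s * fps_X + Abs_fps (\<lambda>m. if m \<ge> 2 then k (m - 1) / fact m else 0) = h"
  proof (rule fps_ext)
    fix m :: nat
    consider "m = 0" | "m = 1" | "m \<ge> 2" by linarith
    then show "fps_nth (fps_const s * fps_X +
        Abs_fps (\<lambda>m. if m \<ge> 2 then k (m - 1) / fact m else 0)) m = fps_nth h m"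
    proof cases
      case 3
      then show ?thesis
        using assms(3)[of "m - 1"] by (simp add: fps_X_nth field_simps)
    qed (use assms(1,2) in simp_all)
  qed
  then show ?thesis
    by (simp add: branch_equation_def)
qed


section \<open>The branch at a smooth point\<close>

text \<open>Some \<open>CARD('n)\<close> gradients are independent and all annihilate
  \<open>w\<close>, so their common kernel is the line of \<open>w\<close>. Since
  \<open>w $ None = 1\<close>, only 0 in that line has vanishing x-coordinate.\<close>

lemma smooth_point_equations:
  fixes F :: "'n::finite option mpoly set" and w :: "complex ^ 'n option"
  assumes smooth: "smooth_curve_point F X a"
    and w: "\<And>p. p \<in> F \<Longrightarrow> (\<Sum>v\<in>UNIV. gradient p a $ v * w $ v) = 0" "w $ None = 1"
  obtains P :: "'n \<Rightarrow> 'n option mpoly" where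
    "range P \<subseteq> F"
    "\<forall>u :: complex ^ 'n option. u $ None = 0 \<longrightarrow>
       (\<forall>j. (\<Sum>v\<in>UNIV. gradient (P j) a $ v * u $ v) = 0) \<longrightarrow> u = 0"
proof -
  obtain B where B: "B \<subseteq> (\<lambda>p. gradient p a) ` F" "vec.independent B" "card B = CARD('n)"
    using vec.basis_exists[of "(\<lambda>p. gradient p a) ` F"] smooth
    by (metis smooth_curve_point_def card_option diff_Suc_1)
  \<comment> \<open>The basis is labelled by the y-variables, in any order, to match the shape of
    \<open>mpoly_jacobian\<close>.\<close>
  obtain b :: "'n \<Rightarrow> complex ^ 'n option" where b: "bij_betw b UNIV B"
    using finite_same_card_bij[of "UNIV :: 'n set" B] vec.finiteI_independent[OF B(2)] B(3) by auto
  have "b j \<in> (\<lambda>p. gradient p a) ` F" for j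
    using B(1) bij_betwE[OF b] by auto
  then have "\<exists>p. p \<in> F \<and> gradient p a = b j" for j
    by (metis imageE)
  then obtain P where P: "\<And>j. P j \<in> F" "\<And>j. gradient (P j) a = b j"
    by metis
  show ?thesis
  proof (rule that)
    show "range P \<subseteq> F" using P(1) by blast
    have B_eq: "B = range b"
      using b by (simp add: bij_betw_def)
    have "u = 0" if u: "u $ None = 0" "\<forall>j. (\<Sum>v\<in>UNIV. gradient (P j) a $ v * u $ v) = 0"
      for u :: "complex ^ 'n option"
    proof (rule annihilator_of_hyperplane_family[OF B(2) _ _ w(2) _ u(1)])
      show "Suc (card B) = CARD('n option)"
        by (simp add: B(3) card_option)
      show "(\<Sum>v\<in>UNIV. c $ v * w $ v) = 0" if "c \<in> B" for c
        using that B(1) w(1) by blast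
      show "(\<Sum>v\<in>UNIV. c $ v * u $ v) = 0" if "c \<in> B" for c
        using that u(2) by (auto simp: B_eq P(2))
    qed
    then show "\<forall>u :: complex ^ 'n option. u $ None = 0 \<longrightarrow>
        (\<forall>j. (\<Sum>v\<in>UNIV. gradient (P j) a $ v * u $ v) = 0) \<longrightarrow> u = 0"
      by blast
  qed
qed

text \<open>
  Dividing the chain rule for \<open>p(\<gamma>(t)) = 0\<close> by \<open>x'(t)\<close> shows that \<open>(1, s\<^sub>1(0), \<dots>, s\<^sub>n(0))\<close> is a
  tangent vector, even if \<open>\<gamma>\<close> itself is not immersive.
\<close>

lemma gradient_slope_vector:
  fixes \<gamma> :: "'v::finite \<Rightarrow> complex fps"
  assumes "\<And>v. fps_nth (\<gamma> v) 0 = 0" "mpoly_fps p \<gamma> = 0" "x' \<noteq> 0"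
    and "\<And>v. fps_deriv (\<gamma> v) = \<sigma> v * x'"
  shows "(\<Sum>v\<in>UNIV. gradient p 0 $ v * fps_nth (\<sigma> v) 0) = 0"
proof -
  have "(\<Sum>v\<in>UNIV. mpoly_fps (mpoly_deriv v p) \<gamma> * \<sigma> v) * x' = fps_deriv (mpoly_fps p \<gamma>)"
    by (simp add: fps_deriv_mpoly_fps assms(4) sum_distrib_right mult.assoc)
  then have "(\<Sum>v\<in>UNIV. mpoly_fps (mpoly_deriv v p) \<gamma> * \<sigma> v) = 0"
    using assms(2,3) by simp
  then have "fps_nth (\<Sum>v\<in>UNIV. mpoly_fps (mpoly_deriv v p) \<gamma> * \<sigma> v) 0 = 0"
    by simp
  then show ?thesis
    by (simp add: fps_sum_nth fps_nth_0_mpoly_fps[OF assms(1)] gradient_def)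
qed

theorem corollary1p2:
  fixes X :: "(complex ^ 'n::finite option) set"
    and r :: nat
    and f :: "nat \<Rightarrow> 'n option mpoly"
    and \<gamma> :: "'n option \<Rightarrow> complex fps"
    and s :: "'n \<Rightarrow> 'n option mquot"
    and \<kappa> :: "nat \<Rightarrow> 'n \<Rightarrow> 'n option mquot"
  assumes "algebraic_curve X"
    and "ideal_generated (f ` {1..r}) = vanishing_ideal X"
    and "smooth_curve_point (f ` {1..r}) X 0"
    and "parametrization X \<gamma>"
    and "fps_deriv (\<gamma> None) \<noteq> 0"
    and "\<And>j. implicit_expression (f ` {1..r}) \<gamma> (slope (\<gamma> None) (\<gamma> (Some j))) (s j)"
    and "\<And>i j. i \<ge> 1 \<Longrightarrow>
           implicit_expression (f ` {1..r}) \<gamma> (curvature (\<gamma> None) (\<gamma> (Some j)) i) (\<kappa> i j)"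
    and "\<And>j. finite_at_0 (s j)"
    and "\<And>i j. i \<ge> 1 \<Longrightarrow> finite_at_0 (\<kappa> i j)"
  shows "let g = (\<lambda>j. branch_equation j (value_at_0 (s j)) (\<lambda>i. value_at_0 (\<kappa> i j)))
         in (\<forall>j. mfps_convergent (g j)) \<and> germ_defined_by X (convergent_ideal (range g))"
proof -
  let ?F = "f ` {1..r}" and ?x = "\<gamma> None"
  have \<gamma>0: "fps_nth (\<gamma> v) 0 = 0" for v
    using assms(4) by (simp add: parametrization_def)
  have X_eq: "X = {a. \<forall>p\<in>?F. mpoly_eval p a = 0}"
    using assms(1,2) by (intro zariski_closed_eq_zeros) (simp_all add: algebraic_curve_def)
  have F_\<gamma>: "mpoly_fps p \<gamma> = 0" if "p \<in> ?F" for p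
    using that ideal_generated_superset[of ?F] unfolding assms(2)
    by (intro mpoly_fps_parametrization[OF assms(4)]) (rule subsetD)
  have "0 \<in> X"
    using assms(3) by (simp add: smooth_curve_point_def)
  then have F_0: "mpoly_eval p 0 = 0" if "p \<in> ?F" for p
    using that X_eq by blast

  \<comment> \<open>Finite values at 0 make the slopes power series rather than Laurent series, so
    they have constant terms even if x'(0) = 0.\<close>
  have "\<exists>u. slope ?x (\<gamma> (Some j)) = fps_to_fls u" for j
    using implicit_expression_finite_at_0[OF assms(6,8) \<gamma>0] by metis
  then obtain \<sigma> where \<sigma>: "\<And>j. slope ?x (\<gamma> (Some j)) = fps_to_fls (\<sigma> j)"
    by metis
  have \<sigma>': "fps_deriv (\<gamma> (Some j)) = \<sigma> j * fps_deriv ?x" for j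
  proof -
    have "fps_to_fls (fps_deriv (\<gamma> (Some j))) = fps_to_fls (\<sigma> j * fps_deriv ?x)"
      using \<sigma>[of j] assms(5) by (simp add: slope_def fls_times_fps_to_fls field_simps)
    then show ?thesis by simp
  qed
  \<comment> \<open>The tangent direction, normalised to x-component 1; in particular it is not
    vertical.\<close>
  define w :: "complex ^ 'n option" where "w = (\<chi> v. fps_nth (case_option 1 \<sigma> v) 0)"
  have deriv_\<gamma>: "fps_deriv (\<gamma> v) = case_option 1 \<sigma> v * fps_deriv ?x" for v
    by (cases v) (simp_all add: \<sigma>')
  have w: "(\<Sum>v\<in>UNIV. gradient p 0 $ v * w $ v) = 0" if "p \<in> ?F" for p
    using gradient_slope_vector[OF \<gamma>0 F_\<gamma>[OF that] assms(5) deriv_\<gamma>] by (simp add: w_def)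
  have "w $ None = 1"
    by (simp add: w_def)
  from smooth_point_equations[OF assms(3) w this]
  obtain P :: "'n \<Rightarrow> 'n option mpoly" where P: "range P \<subseteq> ?F"
    and ker': "\<forall>u :: complex ^ 'n option. u $ None = 0 \<longrightarrow>
       (\<forall>j. (\<Sum>v\<in>UNIV. gradient (P j) 0 $ v * u $ v) = 0) \<longrightarrow> u = 0"
    by blast
  have ker: "u = 0" if "u $ None = 0" "\<And>j. (\<Sum>v\<in>UNIV. gradient (P j) 0 $ v * u $ v) = 0"
    for u :: "complex ^ 'n option"
    using ker' that by blast
  have P_F: "P j \<in> ?F" for j
    using P by blast
  obtain h where h: "\<And>j. fps_conv_radius (h j) > 0" "\<And>j. fps_nth (h j) 0 = 0"
    "\<And>j. mpoly_fps (P j) (case_option fps_X h) = 0"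
    and graph: "\<forall>\<^sub>F a in nhds 0. (\<forall>j. mpoly_eval (P j) a = 0) \<longrightarrow>
      (\<forall>j. a $ Some j = eval_fps (h j) (a $ None))"
  proof (rule implicit_curve[of P])
    show "mpoly_eval (P j) 0 = 0" for j
      by (rule F_0[OF P_F])
  qed (rule ker, assumption, blast, rule that, blast+)

  \<comment> \<open>The parametrization and the formal graph pulled back along x(t) solve the same
    equations \<open>P j\<close> and share their x-coordinate.\<close>
  have \<gamma>_eq: "\<gamma> = (\<lambda>v. case_option fps_X h v oo ?x)"
  proof (rule mpoly_fps_solution_unique[OF ker])
    show "fps_nth (case_option fps_X h v oo ?x) 0 = 0" for v
      by (cases v) (simp_all add: h(2))
    show "mpoly_fps (P j) (\<lambda>v. case_option fps_X h v oo ?x) = 0" for j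
      by (simp add: mpoly_fps_compose[OF \<gamma>0] h(3))
    show "\<gamma> None = case_option fps_X h None oo ?x"
      by (simp only: option.case(1) fps_X_fps_compose_startby0[OF \<gamma>0])
  qed (simp_all add: \<gamma>0 F_\<gamma>[OF P_F])
  have \<gamma>_Some: "\<gamma> (Some j) = h j oo ?x" for j
    using fun_cong[OF \<gamma>_eq, of "Some j"] by simp
  \<comment> \<open>Passage from the chosen \<open>P j\<close> to all generators: composition with a
    nonzero series without constant term is injective.\<close>
  have F_h: "mpoly_fps p (case_option fps_X h) = 0" if "p \<in> ?F" for p
  proof -
    have "mpoly_fps p (case_option fps_X h) oo ?x = 0"
      using mpoly_fps_compose[OF \<gamma>0, of p "case_option fps_X h" None] F_\<gamma>[OF that]
      by (simp flip: \<gamma>_eq)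
    moreover have "?x \<noteq> 0"
      using assms(5) by auto
    ultimately show ?thesis
      by (simp add: fps_compose_eq_0_iff \<gamma>0)
  qed

  define g where "g j = branch_equation j (value_at_0 (s j)) (\<lambda>i. value_at_0 (\<kappa> i j))" for j
  have g: "g j = mfps_var (Some j) - mfps_of_fps None (h j)" for j
    unfolding g_def
  proof (rule branch_equation_eq)
    show "fps_nth (h j) 1 = value_at_0 (s j)"
    proof (rule implicit_expression_finite_at_0[OF assms(6,8) \<gamma>0])
      fix u assume u: "slope ?x (\<gamma> (Some j)) = fps_to_fls u" "fps_nth u 0 = value_at_0 (s j)"
      then have "u = fps_deriv (h j) oo ?x"
        by (simp add: \<gamma>_Some slope_compose[OF \<gamma>0 assms(5)])
      with u(2) show ?thesis by simp
    qed
    show "fact (i + 1) * fps_nth (h j) (i + 1) = value_at_0 (\<kappa> i j)" if i: "i \<ge> 1" for i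
    proof (rule implicit_expression_finite_at_0[OF assms(7,9)[OF i] \<gamma>0])
      fix u assume u: "curvature ?x (\<gamma> (Some j)) i = fps_to_fls u" "fps_nth u 0 = value_at_0 (\<kappa> i j)"
      obtain i' where i': "i = Suc i'"
        using i by (cases i) auto
      \<comment> \<open>With \<open>i = i' + 1\<close> the order is \<open>i + 1\<close>, and its
        value at 0 is \<open>fact (i + 1)\<close> times the coefficient of \<open>h j\<close> at
        \<open>i + 1\<close>.\<close>
      from u(1) have "u = fps_nth_deriv (i' + 2) (h j) oo ?x"
        unfolding i' \<gamma>_Some curvature_compose[OF \<gamma>0 assms(5)] by simp
      then have "fps_nth u 0 = of_nat (fact (i' + 2)) * fps_nth (h j) (i' + 2)"
        by (simp only: fps_compose_nth_0 fps_deriv_maclauren_0)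
      with u(2) show ?thesis
        by (simp add: i' algebra_simps)
    qed
  qed (rule h(2))
  have sum: "\<forall>\<^sub>F a in nhds 0. (mfps_term (g j) a has_sum (a $ Some j - eval_fps (h j) (a $ None))) UNIV" for j
    unfolding g using eventually_norm_vec_nth_less[OF h(1)]
    by (rule eventually_mono) (rule has_sum_var_diff_graph)
  have conv: "mfps_convergent (g j)" for j
    unfolding mfps_convergent_def using sum
    by (rule eventually_mono) (rule has_sum_imp_summable)
  have "\<forall>\<^sub>F a in nhds 0. \<forall>j. mfps_eval (g j) a = a $ Some j - eval_fps (h j) (a $ None)"
    unfolding mfps_eval_def
    by (intro eventually_all_finite eventually_mono[OF sum] infsumI)
  \<comment> \<open>There are finitely many generators, so one neighbourhood serves them
    all.\<close>
  moreover have "\<forall>\<^sub>F a in nhds 0. \<forall>p\<in>?F. (\<forall>j. a $ Some j = eval_fps (h j) (a $ None)) \<longrightarrow> mpoly_eval p a = 0"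
    by (intro eventually_ball_finite ballI eventually_mpoly_eval_graph h(1) F_h) simp_all
  ultimately have "\<forall>\<^sub>F a in nhds 0. a \<in> X \<longleftrightarrow> (\<forall>q\<in>range g. mfps_eval q a = 0)"
    using graph
  proof eventually_elim
    case (elim a)
    have "(\<forall>q\<in>range g. mfps_eval q a = 0) \<longleftrightarrow> (\<forall>j. a $ Some j = eval_fps (h j) (a $ None))"
      using elim(1) by simp
    moreover have "\<forall>j. mpoly_eval (P j) a = 0" if "a \<in> X"
      using that P_F X_eq by blast
    \<comment> \<open>The equations \<open>P j\<close> put \<open>X\<close> inside the graph near 0;
      the vanishing of all generators on the graph gives the reverse inclusion.\<close>
    ultimately show ?case
      using elim(2,3) X_eq by blast
  qed
  then have "germ_defined_by X (convergent_ideal (range g))"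
    unfolding germ_defined_by_def using conv by (intro exI[of _ "range g"]) auto
  with conv show ?thesis
    by (simp add: Let_def flip: g_def)
qed

end
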